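(* Let $d=1$, let $e=1$, and let $Q$ be a probability measure on $\Omega=\{0,1\}^{\mathbb{Z}}$ satisfying the standing assumptions (i) and (ii) of the context. Then for $P$-almost every $\omega\in\Omega_0$, under the quenched law $P_\omega$, the random variables $X_n/\sqrt{n}$ converge in distribution as $n\to\infty$ to the normal distribution $N\big(0,(\mathbb{E}_P(f_e))^2\big)$ with mean $0$ and variance $(\mathbb{E}_P(f_e))^2$.
   Context: Setting. $\Omega=\{0,1\}^{\mathbb{Z}^d}$ (here $d=1$) with its Borel (product) $\sigma$-algebra $\mathfrak{B}$; for $x\in\mathbb{Z}^d$ the shift $\theta_x:\Omega\to\Omega$ is $(\theta_x\omega)(y)=\omega(x+y)$; $e_1,\dots,e_d$ are the standard basis vectors and $\mathcal{E}=\{\pm e_i\}_{i=1}^d$; $\mathcal{P}(\omega)=\{x\in\mathbb{Z}^d:\omega(x)=1\}$. Standing assumptions on $Q$: (i) $Q$ is stationary (invariant) and ergodic with respect to each single shift $\theta_{e_i}$, $i=1,\dots,d$; (ii) $Q(\mathcal{P}(\omega)=\emptyset)<1$. $\Omega_0=\{\omega\in\Omega:\omega(0)=1\}$ (it has positive $Q$-measure), $P=Q(\cdot\mid\Omega_0)$, and $\mathbb{E}_P$ is expectation under $P$. For $e\in\mathcal{E}$, $f_e(\omega)=\min\{k>0:\omega(ke)=1\}$ (almost surely finite). For $v\in\mathbb{Z}^d$, $N_v(\omega)=\{v+f_e(\theta_v\omega)e: e\in\mathcal{E}\}$ is the set of the $2d$ coordinate nearest neighbors of $v$, one in each of the $2d$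 directions. Random walk. For $P$-a.e. $\omega\in\Omega_0$, the quenched law $P_\omega$ on $(\mathbb{Z}^d)^{\mathbb{N}}$ is the law of the Markov chain $\{X_n\}_{n\ge0}$ on $\mathcal{P}(\omega)$ with $X_0=0$ and $P_\omega(X_{n+1}=u\mid X_n=v)=\frac1{2d}$ if $u\in N_v(\omega)$ and $0$ otherwise. *)

theory Defs
  imports "HOL-Probability.Probability"
begin

section \<open>Stationary ergodic environments\<close>

text \<open>
  A configuration in \<open>{0,1}\<^sup>\<int>\<close> is a function \<open>int \<Rightarrow> bool\<close>; \<open>\<omega> x\<close> stands for \<open>\<omega>(x) = 1\<close>.
\<close>

type_synonym env = "int \<Rightarrow> bool"

definition env_space :: "env measure" where
  "env_space = PiM UNIV (\<lambda>_. count_space UNIV)"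

definition shift :: "int \<Rightarrow> env \<Rightarrow> env" where
  "shift x \<omega> = (\<lambda>y. \<omega> (x + y))"

definition points :: "env \<Rightarrow> int set" where
  "points \<omega> = {x. \<omega> x}"

definition stationary :: "env measure \<Rightarrow> bool" where
  "stationary Q \<longleftrightarrow> distr Q env_space (shift 1) = Q"

definition ergodic :: "env measure \<Rightarrow> bool" where
  "ergodic Q \<longleftrightarrow> (\<forall>A\<in>sets Q. shift 1 -` A = A \<longrightarrow> measure Q A = 0 \<or> measure Q A = 1)"

definition env_law :: "env measure \<Rightarrow> bool" where
  "env_law Q \<longleftrightarrow>
     prob_space Q \<and> sets Q = sets env_space \<and>
     stationary Q \<and> ergodic Q \<and>
     measure Q {\<omega> \<in> space Q. points \<omega> = {}} < 1"

definition Omega0 :: "env set" where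
  "Omega0 = {\<omega>. \<omega> 0}"

definition palm :: "env measure \<Rightarrow> env measure" where
  "palm Q = uniform_measure Q Omega0"

section \<open>The walk on the nearest points\<close>

text \<open>
  For \<open>e = 1\<close> or \<open>e = -1\<close>, \<open>next_dist e \<omega>\<close> is the distance from the origin to the first point
  strictly in direction \<open>e\<close>. Its value is arbitrary if there is no such point, which has
  probability zero.
\<close>

definition next_dist :: "int \<Rightarrow> env \<Rightarrow> nat" where
  "next_dist e \<omega> = (LEAST k. 0 < k \<and> \<omega> (int k * e))"

definition nbrs :: "env \<Rightarrow> int \<Rightarrow> int set" where
  "nbrs \<omega> v = (\<lambda>e. v + int (next_dist e (shift v \<omega>)) * e) ` {1, -1}"

definition trans_prob :: "env \<Rightarrow> int \<Rightarrow> int \<Rightarrow> real" where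
  "trans_prob \<omega> v u = (if u \<in> nbrs \<omega> v then 1 / 2 else 0)"

definition path_space :: "(nat \<Rightarrow> int) measure" where
  "path_space = PiM UNIV (\<lambda>_. count_space UNIV)"

definition is_walk_law :: "env \<Rightarrow> (nat \<Rightarrow> int) measure \<Rightarrow> bool" where
  "is_walk_law \<omega> M \<longleftrightarrow>
     prob_space M \<and> sets M = sets path_space \<and>
     \<P>(X in M. X 0 = 0) = 1 \<and>
     (\<forall>n x u. \<P>(X in M. \<forall>i\<le>n. X i = x i) > 0 \<longrightarrow>
        \<P>(X in M. X (Suc n) = u \<bar> \<forall>i\<le>n. X i = x i) = trans_prob \<omega> (x n) u)"

text \<open>
  If there are points arbitrarily far to the left and to the right, which is the case for almost
  every environment, then exactly one measure satisfies \<open>is_walk_law\<close>; see \<open>ex1_walk_law\<close> below.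
\<close>

definition quenched_law :: "env \<Rightarrow> (nat \<Rightarrow> int) measure" where
  "quenched_law \<omega> = (THE M. is_walk_law \<omega> M)"

section \<open>Existence and uniqueness of the quenched law\<close>

definition two_sided :: "env \<Rightarrow> bool" where
  "two_sided \<omega> \<longleftrightarrow> (\<forall>v. (\<exists>x>v. \<omega> x) \<and> (\<exists>x<v. \<omega> x))"

definition step :: "env \<Rightarrow> int \<Rightarrow> int \<Rightarrow> int" where
  "step \<omega> v e = v + int (next_dist e (shift v \<omega>)) * e"

primrec walk :: "env \<Rightarrow> int \<Rightarrow> (nat \<Rightarrow> int) \<Rightarrow> nat \<Rightarrow> int" where
  "walk \<omega> v c 0 = v"
| "walk \<omega> v c (Suc n) = step \<omega> (walk \<omega> v c n) (c n)"

abbreviation coin :: "int measure" where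
  "coin \<equiv> measure_pmf (pmf_of_set {1, -1})"

abbreviation coins :: "(nat \<Rightarrow> int) measure" where
  "coins \<equiv> PiM UNIV (\<lambda>_. coin)"

definition cyl :: "nat \<Rightarrow> (nat \<Rightarrow> int) \<Rightarrow> (nat \<Rightarrow> int) set" where
  "cyl n x = {X. \<forall>i\<le>n. X i = x i}"

lemma next_dist_props:
  assumes "two_sided \<omega>" "e \<in> {1, -1}"
  shows "0 < next_dist e (shift v \<omega>)" "\<omega> (step \<omega> v e)"
proof -
  have "\<exists>k>0. shift v \<omega> (int k * e)"
  proof -
    obtain x where x: "\<omega> x" "(x - v) * e > 0"
      using assms unfolding two_sided_def
      by (metis diff_gt_0_iff_gt insertE minus_diff_eq mult.right_neutral mult_minus_right
          singletonD)
    then have "nat ((x - v) * e) > 0 \<and> shift v \<omega> (int (nat ((x - v) * e)) * e)"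
      using assms(2) by (auto simp: shift_def)
    then show ?thesis by blast
  qed
  from LeastI_ex[OF this] show "0 < next_dist e (shift v \<omega>)" "\<omega> (step \<omega> v e)"
    by (auto simp: next_dist_def step_def shift_def)
qed

lemma step_neq: "two_sided \<omega> \<Longrightarrow> step \<omega> v 1 \<noteq> step \<omega> v (-1)"
  using next_dist_props(1)[of \<omega> 1 v] next_dist_props(1)[of \<omega> "-1" v] by (auto simp: step_def)

lemma nbrs_step: "nbrs \<omega> v = {step \<omega> v 1, step \<omega> v (-1)}"
  by (auto simp: nbrs_def step_def)

lemma space_path_space [simp]: "space path_space = UNIV"
  by (simp add: path_space_def space_PiM)

lemma measurable_coord [measurable]: "(\<lambda>X. X i) \<in> measurable path_space (count_space UNIV)"
  unfolding path_space_def by simp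

lemma sets_cyl [measurable]: "cyl n x \<in> sets path_space"
proof -
  have "cyl n x = {X \<in> space path_space. \<forall>i\<in>{..n}. X i = x i}"
    by (auto simp: cyl_def)
  also have "\<dots> \<in> sets path_space" by measurable
  finally show ?thesis .
qed

lemma sets_coins: "sets coins = sets path_space"
  unfolding path_space_def by (intro sets_PiM_cong) auto

lemma space_coins [simp]: "space coins = UNIV"
  by (simp add: space_PiM)

lemma measurable_walk_coord [measurable]:
  "(\<lambda>c. walk \<omega> v c n) \<in> measurable coins (count_space UNIV)"
proof (induction n)
  case (Suc n)
  have "(\<lambda>c. c n) \<in> measurable coins (count_space UNIV)"
    using measurable_coord measurable_cong_sets[OF sets_coins refl] by blast
  then have "(\<lambda>c. step \<omega> a (c n)) \<in> measurable coins (count_space UNIV)" for a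
    by (rule measurable_compose) simp
  from measurable_compose_countable[OF this Suc] show ?case by simp
qed simp

lemma measurable_walk [measurable]: "walk \<omega> v \<in> measurable coins path_space"
  unfolding path_space_def by (rule measurable_PiM_single') auto

lemma walk_case_nat: "walk \<omega> v (case_nat s c) (Suc n) = walk \<omega> (step \<omega> v s) c n"
  by (induction n) auto

lemma ennreal_half: "ennreal (1 / 2) = 1 / 2"
  using divide_ennreal[of 1 2] by simp

lemma nn_integral_coin: "(\<integral>\<^sup>+s. f s \<partial>coin) = (f 1 + f (-1)) / 2"
proof -
  have "(\<integral>\<^sup>+s. f s \<partial>coin) = (\<Sum>s\<in>{1,-1}. f s * ennreal (1/2))"
    by (subst nn_integral_measure_pmf_support[of "{1,-1}"]) (auto simp: pmf_of_set)
  also have "\<dots> = (f 1 + f (-1)) / 2"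
    unfolding ennreal_half by (simp add: divide_ennreal_def distrib_right)
  finally show ?thesis .
qed

lemma emeasure_coins_cyl:
  assumes "two_sided \<omega>"
  shows "emeasure coins {c. walk \<omega> v c \<in> cyl n x} =
     ennreal (of_bool (x 0 = v) * (\<Prod>i<n. trans_prob \<omega> (x i) (x (Suc i))))"
proof (induction n arbitrary: v x)
  case 0
  interpret prob_space coins by (intro prob_space_PiM prob_space_measure_pmf)
  show ?case using emeasure_space_1 by (auto simp: cyl_def)
next
  case (Suc n)
  interpret sequence_space coin by unfold_locales
  let ?A = "\<lambda>n v x. {c. walk \<omega> v c \<in> cyl n x}"
  let ?q = "ennreal (\<Prod>i<n. trans_prob \<omega> (x (Suc i)) (x (Suc (Suc i))))"
  have meas: "?A m w y \<in> sets coins" for m w y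
    using measurable_sets[OF measurable_walk sets_cyl] by (simp add: vimage_def)
  have split: "case_nat s c \<in> ?A (Suc n) v x \<longleftrightarrow> x 0 = v \<and> c \<in> ?A n (step \<omega> v s) (x \<circ> Suc)" for s c
  proof -
    have all_Suc: "(\<forall>i\<le>Suc n. R i) \<longleftrightarrow> R 0 \<and> (\<forall>i\<le>n. R (Suc i))" for R
      by (metis Suc_le_mono le0 not0_implies_Suc)
    have "(\<forall>i\<le>Suc n. walk \<omega> v (case_nat s c) i = x i) \<longleftrightarrow>
        v = x 0 \<and> (\<forall>i\<le>n. walk \<omega> v (case_nat s c) (Suc i) = x (Suc i))"
      unfolding all_Suc by simp
    then show ?thesis unfolding walk_case_nat by (auto simp: cyl_def)
  qed
  have "emeasure coins (?A (Suc n) v x) = (\<integral>\<^sup>+c. indicator (?A (Suc n) v x) c \<partial>coins)"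
    using meas by simp
  also have "\<dots> = (\<integral>\<^sup>+c. indicator (?A (Suc n) v x) c \<partial>distr (coin \<Otimes>\<^sub>M coins) coins (\<lambda>(s, c). case_nat s c))"
    by (simp add: PiM_iter)
  also have "\<dots> = (\<integral>\<^sup>+p. indicator (?A (Suc n) v x) (case_nat (fst p) (snd p)) \<partial>(coin \<Otimes>\<^sub>M coins))"
    using meas by (subst nn_integral_distr) (auto simp: split_beta')
  also have "\<dots> = (\<integral>\<^sup>+s. (\<integral>\<^sup>+c. indicator (?A (Suc n) v x) (case_nat s c) \<partial>coins) \<partial>coin)"
    using meas[of v "Suc n" x] by (subst nn_integral_fst[symmetric]) auto
  also have "\<dots> = (\<integral>\<^sup>+s. of_bool (x 0 = v) * emeasure coins (?A n (step \<omega> v s) (x \<circ> Suc)) \<partial>coin)"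
  proof (intro nn_integral_cong)
    fix s
    have "(\<integral>\<^sup>+c. indicator (?A (Suc n) v x) (case_nat s c) \<partial>coins) =
       (\<integral>\<^sup>+c. of_bool (x 0 = v) * indicator (?A n (step \<omega> v s) (x \<circ> Suc)) c \<partial>coins)"
      by (intro nn_integral_cong) (simp only: indicator_def split, auto)
    then show "(\<integral>\<^sup>+c. indicator (?A (Suc n) v x) (case_nat s c) \<partial>coins) =
       of_bool (x 0 = v) * emeasure coins (?A n (step \<omega> v s) (x \<circ> Suc))"
      using meas[of "step \<omega> v s" n "x \<circ> Suc"] by (simp add: nn_integral_cmult)
  qed
  also have "\<dots> = (\<integral>\<^sup>+s. of_bool (x 0 = v) * (of_bool (x 1 = step \<omega> v s) * ?q) \<partial>coin)"
    unfolding Suc by (intro nn_integral_cong) auto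
  also have "\<dots> = ennreal (of_bool (x 0 = v) * (\<Prod>i<Suc n. trans_prob \<omega> (x i) (x (Suc i))))"
  proof -
    have "ennreal (trans_prob \<omega> v (x 1)) = (of_bool (x 1 = step \<omega> v 1) + of_bool (x 1 = step \<omega> v (-1))) / 2"
      using step_neq[OF assms, of v]
      by (auto simp: trans_prob_def nbrs_step ennreal_half divide_ennreal_def)
    moreover have "(a * ?q + b * ?q) / 2 = (a + b) / 2 * ?q" for a b :: ennreal
      by (simp add: divide_ennreal_def algebra_simps)
    moreover have "(\<Prod>i<Suc n. trans_prob \<omega> (x i) (x (Suc i))) =
        trans_prob \<omega> (x 0) (x 1) * (\<Prod>i<n. trans_prob \<omega> (x (Suc i)) (x (Suc (Suc i))))"
      by (subst prod.lessThan_Suc_shift) simp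
    moreover have "trans_prob \<omega> a b \<ge> 0" for a b by (simp add: trans_prob_def)
    ultimately show ?thesis
      by (auto simp: nn_integral_coin ennreal_mult prod_nonneg)
  qed
  finally show ?case .
qed

lemma walk_law_exists:
  assumes "two_sided \<omega>"
  shows "is_walk_law \<omega> (distr coins path_space (walk \<omega> 0))"
proof -
  interpret S: prob_space coins by (intro prob_space_PiM prob_space_measure_pmf)
  let ?M = "distr coins path_space (walk \<omega> 0)"
  interpret M: prob_space ?M by (intro S.prob_space_distr measurable_walk)
  have nonneg: "trans_prob \<omega> a b \<ge> 0" for a b by (simp add: trans_prob_def)
  have M: "measure ?M (cyl n x) =
      of_bool (x 0 = 0) * (\<Prod>i<n. trans_prob \<omega> (x i) (x (Suc i)))" for n x
  proof -
    have "emeasure ?M (cyl n x) = emeasure coins {c. walk \<omega> 0 c \<in> cyl n x}"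
      by (subst emeasure_distr) (auto simp: vimage_def)
    then show ?thesis
      unfolding emeasure_coins_cyl[OF assms] measure_def by (simp add: prod_nonneg nonneg)
  qed
  have "{X \<in> space ?M. X 0 = 0} = cyl 0 (\<lambda>_. 0)" by (auto simp: cyl_def)
  then have 1: "\<P>(X in ?M. X 0 = 0) = 1" by (simp add: M)
  have 2: "\<P>(X in ?M. X (Suc n) = u \<bar> \<forall>i\<le>n. X i = x i) = trans_prob \<omega> (x n) u"
    if "\<P>(X in ?M. \<forall>i\<le>n. X i = x i) > 0" for n x u
  proof -
    let ?y = "x(Suc n := u)"
    have eq: "{X \<in> space ?M. X (Suc n) = u \<and> (\<forall>i\<le>n. X i = x i)} = cyl (Suc n) ?y"
      by (auto simp: cyl_def le_Suc_eq)
    have eq': "{X \<in> space ?M. \<forall>i\<le>n. X i = x i} = cyl n x" by (auto simp: cyl_def)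
    have "measure ?M (cyl (Suc n) ?y) = measure ?M (cyl n x) * trans_prob \<omega> (x n) u"
      unfolding M by simp
    then show ?thesis using that unfolding cond_prob_def eq eq' by simp
  qed
  show ?thesis
    unfolding is_walk_law_def using M.prob_space_axioms 1 2 by simp
qed

lemma walk_law_cyl:
  assumes "is_walk_law \<omega> M"
  shows "measure M (cyl n x) = of_bool (x 0 = 0) * (\<Prod>i<n. trans_prob \<omega> (x i) (x (Suc i)))"
proof -
  from assms interpret prob_space M by (simp add: is_walk_law_def)
  from assms have sets[measurable_cong]: "sets M = sets path_space" by (simp add: is_walk_law_def)
  then have sp: "space M = UNIV" using sets_eq_imp_space_eq by fastforce
  have cylM: "cyl n x \<in> sets M" for n x by (simp add: sets)
  show ?thesis
  proof (induction n)
    case 0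
    have *: "{X. X 0 = 0} = cyl 0 (\<lambda>_. 0)" by (auto simp: cyl_def)
    have 1: "measure M (cyl 0 (\<lambda>_. 0)) = 1" using assms by (simp add: is_walk_law_def sp flip: *)
    show ?case
    proof (cases "x 0 = 0")
      case True
      then have "cyl 0 x = cyl 0 (\<lambda>_. 0)" by (auto simp: cyl_def)
      then show ?thesis using 1 True by simp
    next
      case False
      then have "cyl 0 x \<subseteq> space M - cyl 0 (\<lambda>_. 0)" by (auto simp: cyl_def sp)
      then have "measure M (cyl 0 x) \<le> measure M (space M - cyl 0 (\<lambda>_. 0))"
        by (intro finite_measure_mono) (auto simp: cylM)
      then show ?thesis using False prob_compl[OF cylM[of 0 "\<lambda>_. 0"]] 1
        by (simp add: measure_le_0_iff)
    qed
  next
    case (Suc n)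
    have eq: "{X \<in> space M. X (Suc n) = x (Suc n) \<and> (\<forall>i\<le>n. X i = x i)} = cyl (Suc n) x"
      by (auto simp: cyl_def le_Suc_eq sp)
    have eq': "{X \<in> space M. \<forall>i\<le>n. X i = x i} = cyl n x" by (auto simp: cyl_def sp)
    have "measure M (cyl (Suc n) x) = measure M (cyl n x) * trans_prob \<omega> (x n) (x (Suc n))"
    proof (cases "measure M (cyl n x) > 0")
      case True
      then have "\<P>(X in M. \<forall>i\<le>n. X i = x i) > 0" unfolding eq' .
      then have "\<P>(X in M. X (Suc n) = x (Suc n) \<bar> \<forall>i\<le>n. X i = x i) = trans_prob \<omega> (x n) (x (Suc n))"
        using assms unfolding is_walk_law_def by blast
      then show ?thesis using True unfolding cond_prob_def eq eq' by (simp add: field_simps)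
    next
      case False
      then have "measure M (cyl n x) = 0" by (simp add: zero_less_measure_iff)
      moreover have "measure M (cyl (Suc n) x) \<le> measure M (cyl n x)"
        by (intro finite_measure_mono cylM) (auto simp: cyl_def)
      ultimately show ?thesis by (simp add: measure_le_0_iff)
    qed
    then show ?case using Suc by simp
  qed
qed

lemma walk_law_unique:
  assumes M: "is_walk_law \<omega> M" and N: "is_walk_law \<omega> N"
  shows "M = N"
proof -
  interpret M: prob_space M using M by (simp add: is_walk_law_def)
  interpret N: prob_space N using N by (simp add: is_walk_law_def)
  have setsM: "sets M = sets path_space" and setsN: "sets N = sets path_space"
    using M N by (auto simp: is_walk_law_def)
  have eq: "emeasure M (cyl n x) = emeasure N (cyl n x)" for n x
    using walk_law_cyl[OF M, of n x] walk_law_cyl[OF N, of n x]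
    by (simp add: M.emeasure_eq_measure N.emeasure_eq_measure)
  show ?thesis
  proof (rule measure_eqI_PiM_infinite)
    show "sets M = sets (PiM UNIV (\<lambda>_::nat. count_space (UNIV :: int set)))"
      "sets N = sets (PiM UNIV (\<lambda>_::nat. count_space (UNIV :: int set)))"
      using setsM setsN by (simp_all add: path_space_def)
    show "finite_measure M" by unfold_locales
    fix A :: "nat \<Rightarrow> int set" and J :: "nat set"
    assume J: "finite J"
    let ?E = "prod_emb UNIV (\<lambda>_. count_space UNIV) J (Pi\<^sub>E J A)"
    define n where "n = Max (insert 0 J)"
    have Jn: "i \<le> n" if "i \<in> J" for i using J that by (simp add: n_def)
    define L where "L = {l. length l = Suc n \<and> (\<forall>i\<in>J. l ! i \<in> A i)}"
    have E: "?E = (\<Union>l\<in>L. cyl n ((!) l))"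
    proof (intro set_eqI iffI)
      fix X assume "X \<in> ?E"
      then have "map X [0..<Suc n] \<in> L" "X \<in> cyl n ((!) (map X [0..<Suc n]))"
        using Jn by (auto simp: L_def cyl_def prod_emb_iff PiE_iff less_Suc_eq_le nth_append
            simp del: upt_Suc)
      then show "X \<in> (\<Union>l\<in>L. cyl n ((!) l))" by blast
    qed (use Jn in \<open>auto simp: L_def cyl_def prod_emb_iff PiE_iff\<close>)
    have disj: "disjoint_family_on (\<lambda>l. cyl n ((!) l)) L"
      unfolding disjoint_family_on_def
    proof (intro ballI impI)
      fix k l assume "k \<in> L" "l \<in> L" "k \<noteq> l"
      then obtain i where "i \<le> n" "k ! i \<noteq> l ! i"
        by (auto simp: L_def list_eq_iff_nth_eq less_Suc_eq_le)
      then show "cyl n ((!) k) \<inter> cyl n ((!) l) = {}" by (force simp: cyl_def)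
    qed
    have "emeasure M ?E = (\<integral>\<^sup>+l. emeasure M (cyl n ((!) l)) \<partial>count_space L)"
      unfolding E using disj by (intro emeasure_UN_countable) (auto simp: setsM)
    also have "\<dots> = (\<integral>\<^sup>+l. emeasure N (cyl n ((!) l)) \<partial>count_space L)"
      by (simp add: eq)
    also have "\<dots> = emeasure N ?E"
      unfolding E using disj by (intro emeasure_UN_countable[symmetric]) (auto simp: setsN)
    finally show "emeasure M ?E = emeasure N ?E" .
  qed
qed

theorem ex1_walk_law: "two_sided \<omega> \<Longrightarrow> \<exists>!M. is_walk_law \<omega> M"
  using walk_law_exists walk_law_unique by blast

end

theory Submission
  imports Defs
begin

text \<open>
  If \<open>t\<^sub>k\<close> (\<open>k \<in> \<int>\<close>) enumerates the points of \<open>\<omega>\<close> in increasing order with \<open>t\<^sub>0 = 0\<close>, then the walk is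
  \<open>X\<^sub>n = t\<close> evaluated at \<open>S\<^sub>n\<close>, where \<open>S\<close> is the simple random walk on \<open>\<int>\<close>. The pointwise ergodic theorem,
  applied to the shift and to its inverse, gives the density \<open>p = Q(\<Omega>\<^sub>0)\<close> of the points in both
  directions, hence \<open>t\<^sub>k / k\<close> tends to \<open>1 / p\<close> as \<open>\<bar>k\<bar>\<close> grows, and \<open>1 / p\<close> is the mean gap by Kac's formula. So
  \<open>X\<^sub>n / \<surd>n\<close> differs from \<open>S\<^sub>n / (p \<surd>n)\<close> by a term that vanishes in mean, and the classical central
  limit theorem applies.
\<close>

section \<open>The pointwise ergodic theorem\<close>

text \<open>
  The maximum of the Birkhoff sums of length at most \<open>n\<close>, defined by the recursion that Garsia's
  proof of the maximal ergodic theorem uses.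
\<close>

primrec max_sum :: "('a \<Rightarrow> 'a) \<Rightarrow> ('a \<Rightarrow> real) \<Rightarrow> nat \<Rightarrow> 'a \<Rightarrow> real" where
  "max_sum T g 0 x = 0"
| "max_sum T g (Suc n) x = max 0 (g x + max_sum T g n (T x))"

lemma max_sum_nonneg: "0 \<le> max_sum T g n x"
  by (cases n) auto

lemma max_sum_le_Suc: "max_sum T g n x \<le> max_sum T g (Suc n) x"
proof (induction n arbitrary: x)
  case (Suc n)
  from Suc[of "T x"] show ?case by (simp add: max_def)
qed simp

lemma max_sum_mono: "m \<le> n \<Longrightarrow> max_sum T g m x \<le> max_sum T g n x"
  by (rule lift_Suc_mono_le[of "\<lambda>n. max_sum T g n x"]) (rule max_sum_le_Suc)

lemma birkhoff_sum_le_max_sum: "(\<Sum>k<n. g ((T ^^ k) x)) \<le> max_sum T g n x"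
proof (induction n arbitrary: x)
  case (Suc n)
  have "(\<Sum>k<Suc n. g ((T ^^ k) x)) = g x + (\<Sum>k<n. g ((T ^^ k) (T x)))"
    by (subst sum.lessThan_Suc_shift) (simp add: funpow_swap1)
  also have "\<dots> \<le> max_sum T g (Suc n) x" using Suc[of "T x"] by simp
  finally show ?case .
qed simp

text \<open>Triviality is demanded of exactly invariant sets, the form taken by
  \<open>ergodic\<close>; a set to which it is applied must therefore be invariant pointwise, not
  just up to a null set.\<close>

locale ergodic_system = prob_space +
  fixes T :: "'a \<Rightarrow> 'a"
  assumes measurable_T [measurable]: "T \<in> measurable M M"
    and distr_T: "distr M M T = M"
    and invariant_trivial: "A \<in> sets M \<Longrightarrow> T -` A \<inter> space M = A \<Longrightarrow> prob A = 0 \<or> prob A = 1"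
begin

lemma integrable_comp_T: "integrable M g \<Longrightarrow> integrable M (\<lambda>x. g (T x))"
  for g :: "'a \<Rightarrow> real"
  using integrable_distr[OF measurable_T] distr_T by metis

lemma integral_comp_T: "g \<in> borel_measurable M \<Longrightarrow> (\<integral>x. g (T x) \<partial>M) = (\<integral>x. g x \<partial>M)"
  for g :: "'a \<Rightarrow> real"
  using integral_distr[OF measurable_T, of g] distr_T by simp

lemma integrable_max_sum: "integrable M g \<Longrightarrow> integrable M (max_sum T g n)"
proof (induction n)
  case 0
  have "max_sum T g 0 = (\<lambda>x. 0)" by auto
  then show ?case by simp
next
  case (Suc n)
  have "max_sum T g (Suc n) = (\<lambda>x. max 0 (g x + max_sum T g n (T x)))" by auto
  then show ?case using Suc by (auto intro!: integrable_comp_T)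
qed

lemma measurable_max_sum [measurable]: "g \<in> borel_measurable M \<Longrightarrow> max_sum T g n \<in> borel_measurable M"
proof (induction n)
  case 0
  have "max_sum T g 0 = (\<lambda>x. 0)" by auto
  then show ?case by simp
next
  case (Suc n)
  have [measurable]: "g \<in> borel_measurable M" "max_sum T g n \<in> borel_measurable M" using Suc by auto
  have "max_sum T g (Suc n) = (\<lambda>x. max 0 (g x + max_sum T g n (T x)))" by auto
  then show ?case by simp
qed

text \<open>Garsia's argument: where \<open>max_sum T g (Suc n) x\<close> is positive it equals
  \<open>g x + max_sum T g n (T x)\<close>, elsewhere it is 0 and \<open>max_sum T g n (T x)\<close>
  is nonnegative. So the difference of these two maxima is at most \<open>g\<close> times the
  indicator, while its integral is nonnegative by monotonicity in \<open>n\<close> and invariance of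
  the measure.\<close>

lemma maximal_ergodic:
  assumes g: "integrable M g"
  shows "0 \<le> (\<integral>x. indicator {x \<in> space M. 0 < max_sum T g (Suc n) x} x * g x \<partial>M)"
proof -
  have [measurable]: "g \<in> borel_measurable M" using g by auto
  note I = integrable_max_sum[OF g]
  have "(\<integral>x. max_sum T g n (T x) \<partial>M) = (\<integral>x. max_sum T g n x \<partial>M)"
    by (rule integral_comp_T) measurable
  also have "\<dots> \<le> (\<integral>x. max_sum T g (Suc n) x \<partial>M)"
    by (intro integral_mono I max_sum_le_Suc)
  finally have "0 \<le> (\<integral>x. max_sum T g (Suc n) x - max_sum T g n (T x) \<partial>M)"
    using I[of n] I[of "Suc n"] by (subst Bochner_Integration.integral_diff) (auto intro: integrable_comp_T simp del: max_sum.simps)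
  also have "\<dots> \<le> (\<integral>x. indicator {x \<in> space M. 0 < max_sum T g (Suc n) x} x * g x \<partial>M)"
  proof (rule integral_mono)
    show "integrable M (\<lambda>x. max_sum T g (Suc n) x - max_sum T g n (T x))"
      by (intro Bochner_Integration.integrable_diff I integrable_comp_T)
    show "integrable M (\<lambda>x. indicator {x \<in> space M. 0 < max_sum T g (Suc n) x} x * g x)"
      using g
      by (intro integrable_real_mult_indicator[where f=g, unfolded mult.commute[of "g _"]])
        measurable
    show "max_sum T g (Suc n) x - max_sum T g n (T x)
        \<le> indicator {x \<in> space M. 0 < max_sum T g (Suc n) x} x * g x" if "x \<in> space M" for x
      using that max_sum_nonneg[of T g n "T x"] by (auto simp: indicator_def max_def)
  qed
  finally show ?thesis .
qed

text \<open>
  The event that the running maximum is unbounded is exactly invariant, and if it had full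
  measure the maximal ergodic theorem would give \<open>\<integral> g \<ge> 0\<close>.
\<close>

lemma AE_birkhoff_sum_bounded:
  fixes g :: "'a \<Rightarrow> real"
  assumes g: "integrable M g" and neg: "(\<integral>x. g x \<partial>M) < 0"
  shows "AE x in M. \<exists>K. \<forall>n. (\<Sum>k<n. g ((T ^^ k) x)) \<le> K"
proof -
  have [measurable]: "g \<in> borel_measurable M" using g by auto
  define E where "E = {x \<in> space M. \<forall>K::nat. \<exists>n. real K < max_sum T g n x}"
  have E_sets [measurable]: "E \<in> sets M" unfolding E_def by measurable
  \<comment> \<open>\<open>max_sum T g (Suc n) x\<close> is at least
    \<open>g x + max_sum T g n (T x)\<close>, with equality where it is positive. Since
    \<open>g x\<close> is finite, the maxima along the orbits of \<open>x\<close> and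
    \<open>T x\<close> are unbounded together.\<close>
  have "(\<forall>K::nat. \<exists>n. real K < max_sum T g n (T x)) \<longleftrightarrow> (\<forall>K::nat. \<exists>n. real K < max_sum T g n x)" for x
  proof (intro iffI allI)
    fix K :: nat
    assume unb: "\<forall>K::nat. \<exists>n. real K < max_sum T g n (T x)"
    obtain L :: nat where "real K - g x < real L" using reals_Archimedean2 by blast
    moreover obtain n where "real L < max_sum T g n (T x)" using unb by blast
    ultimately have "real K < max_sum T g (Suc n) x" by simp
    then show "\<exists>n. real K < max_sum T g n x" by blast
  next
    fix K :: nat
    assume unb: "\<forall>K::nat. \<exists>n. real K < max_sum T g n x"
    obtain L :: nat where L: "real K + g x < real L" using reals_Archimedean2 by blast
    obtain n where n: "real L < max_sum T g n x" using unb by blast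
    then have "n \<noteq> 0" by (intro notI) simp
    then obtain m where "n = Suc m" using not0_implies_Suc by blast
    with n L have "real K < max_sum T g m (T x)" by (auto simp: max_def split: if_splits)
    then show "\<exists>n. real K < max_sum T g n (T x)" by blast
  qed
  then have "T -` E \<inter> space M = E"
    using measurable_space[OF measurable_T] by (auto simp: E_def)
  then have "prob E = 0 \<or> prob E = 1" by (intro invariant_trivial) measurable
  moreover have "prob E \<noteq> 1"
  proof
    assume "prob E = 1"
    then have full: "AE x in M. x \<in> E" by (simp add: prob_eq_1)
    \<comment> \<open>On \<open>E\<close> the running maximum eventually becomes and stays positive,
      so the indicators tend to 1 almost everywhere and dominated convergence removes them.\<close>
    have "(\<lambda>n. \<integral>x. indicator {x \<in> space M. 0 < max_sum T g (Suc n) x} x * g x \<partial>M)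
        \<longlonglongrightarrow> (\<integral>x. g x \<partial>M)"
    proof (rule integral_dominated_convergence[where w = "\<lambda>x. \<bar>g x\<bar>"])
      show "AE x in M. (\<lambda>n. indicator {x \<in> space M. 0 < max_sum T g (Suc n) x} x * g x) \<longlonglongrightarrow> g x"
        using full
      proof eventually_elim
        case (elim x)
        then have "x \<in> space M" and "\<exists>n. real 0 < max_sum T g n x"
          unfolding E_def by blast+
        then obtain n0 where n0: "0 < max_sum T g n0 x" by auto
        have "\<forall>\<^sub>F n in sequentially. indicator {x \<in> space M. 0 < max_sum T g (Suc n) x} x * g x = g x"
          using eventually_ge_at_top[of n0]
        proof eventually_elim
          case (elim n)
          have "0 < max_sum T g (Suc n) x" using n0 max_sum_mono[of n0 "Suc n" T g x] elim by linarith
          then show ?case using \<open>x \<in> space M\<close> by (simp del: max_sum.simps)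
        qed
        then show ?case by (rule tendsto_eventually)
      qed
    qed (use g in \<open>auto simp: indicator_def simp del: max_sum.simps\<close>)
    then have "0 \<le> (\<integral>x. g x \<partial>M)"
      by (rule LIMSEQ_le_const) (use maximal_ergodic[OF g] in blast)
    with neg show False by simp
  qed
  ultimately have "AE x in M. x \<notin> E" using E_sets by (simp add: prob_eq_0)
  then show ?thesis using AE_space
  proof eventually_elim
    case (elim x)
    then obtain K where "\<And>n. max_sum T g n x \<le> real K" by (auto simp: E_def not_less)
    then show ?case using birkhoff_sum_le_max_sum[of g T x] order_trans by metis
  qed
qed

text \<open>With \<open>b\<close> strictly between the mean and \<open>c\<close>, the function
  \<open>f - b\<close> has negative mean, so its sums stay below some \<open>K\<close>. The slack
  \<open>n * (c - b)\<close> exceeds \<open>K\<close> for large \<open>n\<close>.\<close>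

lemma AE_birkhoff_average_less:
  assumes f: "integrable M f" and c: "(\<integral>x. f x \<partial>M) < c"
  shows "AE x in M. \<forall>\<^sub>F n in sequentially. (\<Sum>k<n. f ((T ^^ k) x)) / real n < c"
proof -
  obtain b where b: "(\<integral>x. f x \<partial>M) < b" "b < c" using c dense by blast
  have "AE x in M. \<exists>K. \<forall>n. (\<Sum>k<n. f ((T ^^ k) x) - b) \<le> K"
    using f b(1) by (intro AE_birkhoff_sum_bounded) (auto simp: prob_space)
  then show ?thesis
  proof eventually_elim
    case (elim x)
    then obtain K where K: "\<And>n. (\<Sum>k<n. f ((T ^^ k) x)) - real n * b \<le> K"
      by (auto simp: sum_subtractf)
    have "\<forall>\<^sub>F n in sequentially. K / (c - b) < real n"
      using filterlim_real_sequentially filterlim_at_top_dense by blast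
    then show ?case using eventually_gt_at_top[of 0]
    proof eventually_elim
      case (elim n)
      then have "K < real n * (c - b)" using b(2) by (simp add: pos_divide_less_eq)
      with K[of n] have "(\<Sum>k<n. f ((T ^^ k) x)) < c * real n" by (simp add: algebra_simps)
      then show ?case using elim by (simp add: pos_divide_less_eq)
    qed
  qed
qed

text \<open>One-sided bounds for \<open>f\<close> and \<open>- f\<close> give the limit. The margins
  run through \<open>1 / Suc m\<close>, so that only countably many null sets are discarded.\<close>

theorem pointwise_ergodic:
  assumes f: "integrable M f"
  shows "AE x in M. (\<lambda>n. (\<Sum>k<n. f ((T ^^ k) x)) / real n) \<longlonglongrightarrow> (\<integral>x. f x \<partial>M)"
proof -
  let ?A = "\<lambda>n x. (\<Sum>k<n. f ((T ^^ k) x)) / real n"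
  let ?\<epsilon> = "\<lambda>m::nat. 1 / real (Suc m)"
  have "AE x in M. \<forall>m. \<forall>\<^sub>F n in sequentially. ?A n x < (\<integral>x. f x \<partial>M) + ?\<epsilon> m"
    unfolding AE_all_countable using f by (intro allI AE_birkhoff_average_less) auto
  moreover have "AE x in M. \<forall>m. \<forall>\<^sub>F n in sequentially.
      (\<Sum>k<n. - f ((T ^^ k) x)) / real n < (\<integral>x. - f x \<partial>M) + ?\<epsilon> m"
    unfolding AE_all_countable using f by (intro allI AE_birkhoff_average_less) auto
  ultimately show ?thesis
  proof eventually_elim
    case (elim x)
    show ?case
    proof (rule tendstoI)
      fix e :: real assume "0 < e"
      then obtain m where m: "?\<epsilon> m < e" using nat_approx_posE by blast
      from elim(1)[rule_format, of m] elim(2)[rule_format, of m]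
      show "\<forall>\<^sub>F n in sequentially. dist (?A n x) (\<integral>x. f x \<partial>M) < e"
      proof eventually_elim
        case (elim n)
        then show ?case using m by (simp add: dist_real_def sum_negf abs_less_iff)
      qed
    qed
  qed
qed

end

section \<open>Density of the points in the two directions\<close>

lemma space_env_space [simp]: "space env_space = UNIV"
  by (simp add: env_space_def space_PiM)

lemma measurable_env_coord [measurable]: "(\<lambda>\<omega>. \<omega> x) \<in> measurable env_space (count_space UNIV)"
  unfolding env_space_def by simp

lemma measurable_shift [measurable]: "shift x \<in> measurable env_space env_space"
proof -
  have "(\<lambda>\<omega> y. \<omega> (x + y)) \<in> measurable env_space (PiM UNIV (\<lambda>_. count_space UNIV))"
    by (rule measurable_PiM_single') auto
  then show ?thesis unfolding env_space_def shift_def .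
qed

lemma shift_shift: "shift x (shift y \<omega>) = shift (x + y) \<omega>"
  by (simp add: shift_def fun_eq_iff algebra_simps)

lemma shift_0 [simp]: "shift 0 \<omega> = \<omega>"
  by (simp add: shift_def)

lemma funpow_shift: "(shift x ^^ k) \<omega> = shift (int k * x) \<omega>"
  by (induction k) (auto simp: shift_shift algebra_simps)

text \<open>The window has \<open>n\<close> sites and includes the origin, which makes
  \<open>counts\<close> the Birkhoff sum of the indicator of \<open>Omega0\<close> under
  \<open>shift e\<close>.\<close>

definition counts :: "env \<Rightarrow> int \<Rightarrow> nat \<Rightarrow> nat" where
  "counts \<omega> e n = (\<Sum>j<n. of_bool (\<omega> (int j * e)))"

definition has_density :: "env \<Rightarrow> real \<Rightarrow> bool" where
  "has_density \<omega> p \<longleftrightarrow> (\<forall>e\<in>{1, -1}. (\<lambda>n. real (counts \<omega> e n) / real n) \<longlonglongrightarrow> p)"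

text \<open>If there were no point from distance \<open>m\<close> on, the counts would never exceed
  \<open>m\<close> and the density would be 0.\<close>

lemma has_density_unbounded:
  assumes "has_density \<omega> p" "0 < p" "e \<in> {1, -1}"
  shows "\<exists>j\<ge>m. \<omega> (int j * e)"
proof (rule ccontr)
  assume no: "\<not> (\<exists>j\<ge>m. \<omega> (int j * e))"
  have bound: "counts \<omega> e n \<le> m" for n
  proof -
    have "counts \<omega> e n = (\<Sum>j\<in>{..<n} \<inter> {..<m}. of_bool (\<omega> (int j * e)))"
      unfolding counts_def by (rule sum.mono_neutral_right) (use no linorder_not_le in \<open>auto simp: of_bool_def\<close>)
    also have "\<dots> \<le> (\<Sum>j\<in>{..<n} \<inter> {..<m}. 1)" by (rule sum_mono) auto
    also have "\<dots> \<le> m" by (auto intro: order_trans[OF card_mono[of "{..<m}"]])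
    finally show ?thesis .
  qed
  have "(\<lambda>n. real (counts \<omega> e n) / real n) \<longlonglongrightarrow> 0"
  proof (rule tendsto_sandwich[OF _ _ tendsto_const lim_const_over_n[of "real m"]])
    show "\<forall>\<^sub>F n in sequentially. real (counts \<omega> e n) / real n \<le> real m / real n"
      using bound by (intro always_eventually allI divide_right_mono) auto
  qed auto
  moreover have "(\<lambda>n. real (counts \<omega> e n) / real n) \<longlonglongrightarrow> p"
    using assms unfolding has_density_def by blast
  ultimately show False using LIMSEQ_unique \<open>0 < p\<close> by fastforce
qed

lemma has_density_two_sided:
  assumes "has_density \<omega> p" "0 < p"
  shows "two_sided \<omega>"
  unfolding two_sided_def
proof (intro allI conjI)
  fix v :: int
  obtain j where "j \<ge> nat v + 1" "\<omega> (int j)"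
    using has_density_unbounded[OF assms, of 1] by auto
  moreover then have "int j > v" by linarith
  ultimately show "\<exists>x>v. \<omega> x" by blast
  obtain i where "i \<ge> nat (- v) + 1" "\<omega> (- int i)"
    using has_density_unbounded[OF assms, of "-1"] by auto
  moreover then have "- int i < v" by linarith
  ultimately show "\<exists>x<v. \<omega> x" by blast
qed

section \<open>Invariance and ergodicity under both unit shifts\<close>

locale stationary_ergodic_env =
  fixes Q :: "env measure"
  assumes env_law: "env_law Q"
begin

sublocale prob_space Q
  using env_law by (simp add: env_law_def)

lemma sets_Q [measurable_cong]: "sets Q = sets env_space"
  using env_law by (simp add: env_law_def)

lemma space_Q [simp]: "space Q = UNIV"
  using sets_eq_imp_space_eq[OF sets_Q] by simp

text \<open>For the inverse shift, replace \<open>Q\<close> by its own image under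
  \<open>shift 1\<close> and cancel the two maps.\<close>

lemma distr_shift: "distr Q Q (shift e) = Q" if "e \<in> {1, -1}"
proof -
  have shift_Q: "shift x \<in> measurable Q Q" for x
    using measurable_cong_sets[OF sets_Q sets_Q] measurable_shift by blast
  have 1: "distr Q Q (shift 1) = Q"
    using env_law distr_cong[OF refl sets_Q, of Q "shift 1" "shift 1"]
    by (simp add: env_law_def stationary_def)
  have "distr Q Q (shift (-1)) = distr (distr Q Q (shift 1)) Q (shift (-1))" by (simp add: 1)
  also have "\<dots> = distr Q Q (shift (-1) \<circ> shift 1)" by (intro distr_distr shift_Q)
  also have "shift (-1) \<circ> shift 1 = (\<lambda>\<omega>. \<omega>)" by (simp add: fun_eq_iff shift_shift)
  also have "distr Q Q (\<lambda>\<omega>. \<omega>) = Q" by simp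
  finally show ?thesis using 1 that by auto
qed

text \<open>The environment to the left of the origin is explored by \<open>shift (-1)\<close>. As
  the two shifts are mutually inverse, a set invariant under one is invariant under the other, and
  \<open>ergodic\<close> applies.\<close>

lemma ergodic_system_shift: "ergodic_system Q (shift e)" if "e \<in> {1, -1}"
proof
  show "shift e \<in> measurable Q Q"
    using measurable_cong_sets[OF sets_Q sets_Q] measurable_shift by blast
  show "distr Q Q (shift e) = Q" using that by (rule distr_shift)
  fix A assume A: "A \<in> sets Q" "shift e -` A \<inter> space Q = A"
  have "shift 1 -` A = A"
  proof (cases "e = 1")
    case False
    with A that have inv: "shift (-1) -` A = A" by simp
    then have "shift 1 -` A = shift 1 -` (shift (-1) -` A)" by simp
    also have "\<dots> = A" by (auto simp: shift_shift)
    finally show ?thesis .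
  qed (use A in simp)
  with A(1) env_law show "prob A = 0 \<or> prob A = 1"
    by (simp add: env_law_def ergodic_def)
qed

lemma prob_shift: "prob {\<omega>. P (shift e \<omega>)} = prob {\<omega>. P \<omega>}"
  if "e \<in> {1, -1}" "Measurable.pred env_space P"
proof -
  have [measurable]: "Measurable.pred Q P" "shift e \<in> measurable Q Q"
    using measurable_cong_sets[OF sets_Q sets_Q] measurable_shift that(2)
      measurable_cong_sets[OF sets_Q refl] by blast+
  have "{\<omega> \<in> space Q. P \<omega>} \<in> events" by measurable
  then have [measurable]: "{\<omega>. P \<omega>} \<in> events" by simp
  have "prob {\<omega>. P \<omega>} = measure (distr Q Q (shift e)) {\<omega>\<in>space Q. P \<omega>}"
    by (simp add: distr_shift[OF that(1)])
  also have "\<dots> = prob {\<omega>. P (shift e \<omega>)}"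
    by (subst measure_distr) (auto simp: vimage_def)
  finally show ?thesis ..
qed

section \<open>Positive intensity and almost sure density of the points\<close>

definition intensity :: real where
  "intensity = prob Omega0"

lemma Omega0_sets [measurable]: "Omega0 \<in> sets Q"
proof -
  have "{\<omega> \<in> space Q. \<omega> 0} \<in> sets Q" by measurable
  then show ?thesis by (simp add: Omega0_def)
qed

text \<open>If the origin were almost surely vacant, stationarity would make every site vacant
  almost surely, hence, by countability, all of them at once. This contradicts the assumption that
  the empty configuration has probability below 1.\<close>

lemma intensity_pos: "0 < intensity"
proof (rule ccontr)
  assume "\<not> 0 < intensity"
  then have 0: "prob {\<omega>. \<omega> 0} = 0"
    by (simp add: intensity_def Omega0_def zero_less_measure_iff)
  have S: "prob {\<omega>. \<omega> (int n * e)} = 0" if "e \<in> {1, -1}" for n e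
  proof (induction n)
    case (Suc n)
    have "prob {\<omega>. shift e \<omega> (int n * e)} = prob {\<omega>. \<omega> (int n * e)}"
      by (rule prob_shift[OF that]) measurable
    then show ?case using Suc by (simp add: shift_def algebra_simps)
  qed (simp add: 0)
  have "prob {\<omega>. \<omega> x} = 0" for x
    using S[of 1 "nat x"] S[of "-1" "nat (- x)"] by (cases "x \<ge> 0") auto
  moreover have "{\<omega>. \<omega> x} \<in> sets Q" for x
  proof -
    have "{\<omega> \<in> space Q. \<omega> x} \<in> sets Q" by measurable
    then show ?thesis by simp
  qed
  ultimately have "AE \<omega> in Q. \<not> \<omega> x" for x
    by (subst (asm) prob_eq_0) auto
  then have "AE \<omega> in Q. \<forall>x. \<not> \<omega> x" unfolding AE_all_countable by blast
  then have "AE \<omega> in Q. \<omega> \<in> {\<omega> \<in> space Q. points \<omega> = {}}"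
    by eventually_elim (simp add: points_def)
  moreover have "{\<omega> \<in> space Q. points \<omega> = {}} \<in> sets Q"
    unfolding points_def by (simp only: Collect_empty_eq) measurable
  ultimately have "prob {\<omega> \<in> space Q. points \<omega> = {}} = 1" by (simp add: prob_eq_1)
  with env_law show False by (simp add: env_law_def)
qed

text \<open>The ergodic theorem for \<open>indicator Omega0\<close> is used once per direction; the
  limit is the same because both shifts preserve the same measure \<open>Q\<close>.\<close>

theorem AE_has_density: "AE \<omega> in Q. has_density \<omega> intensity"
proof -
  have "AE \<omega> in Q. (\<lambda>n. real (counts \<omega> e n) / real n) \<longlonglongrightarrow> intensity" if e: "e \<in> {1, -1}" for e
  proof -
    interpret E: ergodic_system Q "shift e" using e by (rule ergodic_system_shift)
    have int: "integrable Q (indicator Omega0 :: env \<Rightarrow> real)"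
      by (simp add: emeasure_eq_measure)
    have *: "(\<Sum>k<n. indicator Omega0 ((shift e ^^ k) \<omega>)) = real (counts \<omega> e n)" for n \<omega>
      unfolding counts_def of_nat_sum
      by (rule sum.cong) (auto simp: funpow_shift shift_def Omega0_def)
    show ?thesis using E.pointwise_ergodic[OF int] by (simp add: * intensity_def)
  qed
  from this[of 1] this[of "-1"] show ?thesis
    unfolding has_density_def by auto
qed

end

section \<open>Enumeration of the points\<close>

text \<open>No point lies strictly between \<open>v\<close> and its neighbour in direction
  \<open>e\<close>, and \<open>v\<close> itself is a point, so the first point met on the way back
  is \<open>v\<close>.\<close>

lemma step_step:
  assumes "two_sided \<omega>" "\<omega> v" "e \<in> {1, -1}"
  shows "step \<omega> (step \<omega> v e) (- e) = v"
proof -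
  let ?d = "next_dist e (shift v \<omega>)"
  have d: "0 < ?d" using next_dist_props(1)[OF assms(1,3)] .
  have "next_dist (- e) (shift (v + int ?d * e) \<omega>) = ?d"
    unfolding next_dist_def[of "- e"]
  proof (rule Least_equality)
    show "0 < ?d \<and> shift (v + int ?d * e) \<omega> (int ?d * - e)"
      using d \<open>\<omega> v\<close> by (simp add: shift_def)
  next
    fix k assume k: "0 < k \<and> shift (v + int ?d * e) \<omega> (int k * - e)"
    show "?d \<le> k"
    proof (rule ccontr)
      assume "\<not> ?d \<le> k"
      \<comment> \<open>A point \<open>k\<close> sites back from the neighbour lies
        \<open>?d - k\<close> sites ahead of \<open>v\<close>, contradicting the minimality of
        \<open>?d\<close>. The subtraction is on naturals, so it has to be tied to the integer
        one.\<close>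
      then have less: "?d - k < ?d" "0 < ?d - k" "int (?d - k) = int ?d - int k" using k by auto
      from k have "\<omega> (v + (int ?d - int k) * e)" by (simp add: shift_def algebra_simps)
      then have "0 < ?d - k \<and> shift v \<omega> (int (?d - k) * e)"
        using less by (simp add: shift_def)
      then have "?d \<le> ?d - k" unfolding next_dist_def[of e] by (rule Least_le)
      then show False using less by simp
    qed
  qed
  then show ?thesis by (simp add: step_def)
qed

primrec ray :: "env \<Rightarrow> int \<Rightarrow> nat \<Rightarrow> int" where
  "ray \<omega> e 0 = 0"
| "ray \<omega> e (Suc k) = step \<omega> (ray \<omega> e k) e"

text \<open>The two rays are glued at index 0. Keeping them as separate objects suits the density,
  which is known for each direction separately.\<close>

definition point_at :: "env \<Rightarrow> int \<Rightarrow> int" where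
  "point_at \<omega> k = (if 0 \<le> k then ray \<omega> 1 (nat k) else ray \<omega> (-1) (nat (- k)))"

lemma ray_point: "two_sided \<omega> \<Longrightarrow> \<omega> 0 \<Longrightarrow> e \<in> {1, -1} \<Longrightarrow> \<omega> (ray \<omega> e k)"
proof (induction k)
  case (Suc k)
  then show ?case using next_dist_props(2)[of \<omega> e "ray \<omega> e k"] by simp
qed simp

lemma counts_add: "counts \<omega> e (m + n) = counts \<omega> e m + counts (shift (int m * e) \<omega>) e n"
  by (induction n) (auto simp: counts_def shift_def algebra_simps)

text \<open>The window starts at \<open>v\<close> and stops just before the next point, so
  \<open>v\<close> is the only point in it.\<close>

lemma counts_next_dist:
  assumes "two_sided \<omega>" "\<omega> v" "e \<in> {1, -1}"
  shows "counts (shift v \<omega>) e (next_dist e (shift v \<omega>)) = 1"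
proof -
  let ?d = "next_dist e (shift v \<omega>)"
  obtain m where m: "?d = Suc m"
    using next_dist_props(1)[OF assms(1,3), of v] not0_implies_Suc by blast
  have "counts (shift v \<omega>) e ?d =
      of_bool (shift v \<omega> (int 0 * e)) + (\<Sum>j<m. of_bool (shift v \<omega> (int (Suc j) * e)))"
    unfolding counts_def m by (rule sum.lessThan_Suc_shift)
  also have "(\<Sum>j<m. of_bool (shift v \<omega> (int (Suc j) * e))) = (\<Sum>j<m. 0::nat)"
  proof (intro sum.cong refl)
    fix j assume "j \<in> {..<m}"
    then have "Suc j < ?d" by (simp add: m)
    from not_less_Least[OF this[unfolded next_dist_def]]
    show "of_bool (shift v \<omega> (int (Suc j) * e)) = (0::nat)" by simp
  qed
  finally show ?thesis using \<open>\<omega> v\<close> by (simp add: shift_def)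
qed

text \<open>Inverts the counting function: \<open>b k\<close> is the distance of the
  \<open>k\<close>-th point of the ray, and since the window excludes its far end, it holds the
  origin and the \<open>k - 1\<close> points in between when \<open>k > 0\<close>. The bound
  \<open>k \<le> b k\<close> serves to send \<open>b\<close> to infinity.\<close>

lemma ray_eq:
  assumes "two_sided \<omega>" "\<omega> 0" "e \<in> {1, -1}"
  obtains b where "\<And>k. ray \<omega> e k = int (b k) * e" "\<And>k. counts \<omega> e (b k) = k" "\<And>k. k \<le> b k"
proof -
  have "\<exists>b. ray \<omega> e k = int b * e \<and> counts \<omega> e b = k \<and> k \<le> b" for k
  proof (induction k)
    case 0
    show ?case by (intro exI[of _ 0]) (simp add: counts_def)
  next
    case (Suc k)
    then obtain b where b: "ray \<omega> e k = int b * e" "counts \<omega> e b = k" "k \<le> b" by blast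
    let ?d = "next_dist e (shift (ray \<omega> e k) \<omega>)"
    have "0 < ?d" using next_dist_props(1)[OF assms(1,3)] .
    moreover have "counts \<omega> e (b + ?d) = Suc k"
      using counts_next_dist[OF assms(1) ray_point[OF assms] assms(3), of k] b(2)
      unfolding counts_add b(1) by simp
    ultimately show ?case using b
      by (intro exI[of _ "b + ?d"]) (auto simp: step_def algebra_simps)
  qed
  then show ?thesis using that by metis
qed

text \<open>A step away from the origin prolongs a ray by definition; a step towards it retraces the
  ray by \<open>step_step\<close>. At index 0 both rays start at the same site.\<close>

lemma point_at_neighbours:
  assumes "two_sided \<omega>" "\<omega> 0"
  shows "step \<omega> (point_at \<omega> k) 1 = point_at \<omega> (k + 1)"
    and "step \<omega> (point_at \<omega> k) (-1) = point_at \<omega> (k - 1)"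
proof -
  have retrace: "step \<omega> (ray \<omega> e (Suc n)) (- e) = ray \<omega> e n" if "e \<in> {1, -1}" for e n
    using step_step[OF assms(1) ray_point[OF assms that] that] by simp
  show "step \<omega> (point_at \<omega> k) 1 = point_at \<omega> (k + 1)"
  proof (cases "0 \<le> k")
    case True
    then have "nat (k + 1) = Suc (nat k)" by simp
    with True show ?thesis by (simp add: point_at_def)
  next
    case False
    then have n: "nat (- k) = Suc (nat (- (k + 1)))" by simp
    with False have "step \<omega> (point_at \<omega> k) 1 = ray \<omega> (-1) (nat (- (k + 1)))"
      using retrace[of "-1" "nat (- (k + 1))"] by (simp add: point_at_def del: ray.simps)
    then show ?thesis using False by (auto simp: point_at_def)
  qed
  show "step \<omega> (point_at \<omega> k) (-1) = point_at \<omega> (k - 1)"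
  proof (cases "0 < k")
    case True
    then have n: "nat k = Suc (nat (k - 1))" by simp
    with True have "step \<omega> (point_at \<omega> k) (-1) = ray \<omega> 1 (nat (k - 1))"
      using retrace[of 1 "nat (k - 1)"] by (simp add: point_at_def del: ray.simps)
    then show ?thesis using True by (simp add: point_at_def)
  next
    case False
    then have "nat (- (k - 1)) = Suc (nat (- k))" by simp
    then show ?thesis using False by (cases "k = 0") (auto simp: point_at_def)
  qed
qed

lemma walk_eq_point_at:
  assumes "two_sided \<omega>" "\<omega> 0" "\<And>i. c i \<in> {1, -1}"
  shows "walk \<omega> 0 c n = point_at \<omega> (\<Sum>i<n. c i)"
proof (induction n)
  case 0
  show ?case by (simp add: point_at_def)
next
  case (Suc n)
  show ?case using assms(3)[of n] point_at_neighbours[OF assms(1,2)] by (auto simp: Suc)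
qed

text \<open>Along the window lengths \<open>b k\<close> the count is exactly \<open>k\<close>, so
  \<open>k / b k\<close> tends to \<open>p\<close>; inverting gives the mean spacing.\<close>

lemma ray_tendsto:
  assumes "has_density \<omega> p" "0 < p" "\<omega> 0" "e \<in> {1, -1}"
  shows "(\<lambda>k. real_of_int (ray \<omega> e k * e) / real k) \<longlonglongrightarrow> 1 / p"
proof -
  have ts: "two_sided \<omega>" using has_density_two_sided[OF assms(1,2)] .
  from ray_eq[OF ts assms(3,4)] obtain b where
    b: "\<And>k. ray \<omega> e k = int (b k) * e" "\<And>k. counts \<omega> e (b k) = k" "\<And>k. k \<le> b k" by blast
  have "filterlim b at_top sequentially"
    using b(3) by (intro filterlim_at_top_mono[OF filterlim_ident]) auto
  moreover have "(\<lambda>n. real (counts \<omega> e n) / real n) \<longlonglongrightarrow> p"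
    using assms unfolding has_density_def by blast
  ultimately have "(\<lambda>k. real (counts \<omega> e (b k)) / real (b k)) \<longlonglongrightarrow> p"
    by (rule filterlim_compose[rotated])
  then have "(\<lambda>k. 1 / (real k / real (b k))) \<longlonglongrightarrow> 1 / p"
    unfolding b(2) using \<open>0 < p\<close> by (intro tendsto_intros) auto
  moreover have "ray \<omega> e k * e = int (b k)" for k
    using assms(4) by (auto simp: b(1))
  ultimately show ?thesis by simp
qed

lemma linear_bound_of_tendsto:
  fixes b :: "nat \<Rightarrow> real"
  assumes "(\<lambda>k. b k / real k) \<longlonglongrightarrow> m" "0 < \<epsilon>"
  shows "\<exists>C. \<forall>k. \<bar>b k - m * real k\<bar> \<le> \<epsilon> * real k + C"
proof -
  obtain N where N: "\<And>k. N \<le> k \<Longrightarrow> \<bar>b k / real k - m\<bar> < \<epsilon>"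
    using LIMSEQ_D[OF assms] by auto
  \<comment> \<open>The finitely many early deviations are absorbed by their sum. Taking
    \<open>Suc N\<close> instead of \<open>N\<close> includes \<open>k = 0\<close>, so that beyond
    it division by \<open>k\<close> is harmless.\<close>
  let ?C = "\<Sum>k<Suc N. \<bar>b k - m * real k\<bar>"
  have "\<bar>b k - m * real k\<bar> \<le> \<epsilon> * real k + ?C" for k
  proof (cases "k < Suc N")
    case True
    then have "\<bar>b k - m * real k\<bar> \<le> ?C" by (intro member_le_sum) auto
    then show ?thesis using \<open>0 < \<epsilon>\<close> by (simp add: add_increasing)
  next
    case False
    then have k: "N \<le> k" "0 < real k" by auto
    then have "\<bar>b k - m * real k\<bar> = \<bar>b k / real k - m\<bar> * real k"
      by (simp add: abs_mult_pos diff_divide_distrib left_diff_distrib)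
    also have "\<dots> \<le> \<epsilon> * real k" using N[OF k(1)] k(2) by (intro mult_right_mono) auto
    also have "\<dots> \<le> \<epsilon> * real k + ?C" by (simp add: sum_nonneg)
    finally show ?thesis .
  qed
  then show ?thesis by blast
qed

text \<open>The error is split to suit \<open>k\<close> of order \<open>sqrt n\<close>: after
  division by \<open>sqrt n\<close> the linear part stays of order \<epsilon> and the constant part
  vanishes.\<close>

lemma point_at_linear:
  assumes "has_density \<omega> p" "0 < p" "\<omega> 0" "0 < \<epsilon>"
  shows "\<exists>C\<ge>0. \<forall>k. \<bar>real_of_int (point_at \<omega> k) - real_of_int k / p\<bar> \<le> \<epsilon> * \<bar>real_of_int k\<bar> + C"
proof -
  obtain C where C: "\<And>k. \<bar>real_of_int (ray \<omega> 1 k) - 1 / p * real k\<bar> \<le> \<epsilon> * real k + C"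
    using linear_bound_of_tendsto[OF ray_tendsto[OF assms(1-3), of 1] assms(4)] by auto
  obtain D where D: "\<And>k. \<bar>- real_of_int (ray \<omega> (-1) k) - 1 / p * real k\<bar> \<le> \<epsilon> * real k + D"
    using linear_bound_of_tendsto[OF ray_tendsto[OF assms(1-3), of "-1"] assms(4)] by auto
  have "\<bar>real_of_int (point_at \<omega> k) - real_of_int k / p\<bar> \<le> \<epsilon> * \<bar>real_of_int k\<bar> + max 0 (max C D)" for k
  proof (cases "0 \<le> k")
    case True
    then show ?thesis using C[of "nat k"] by (simp add: point_at_def)
  next
    case False
    then have "\<bar>real_of_int (point_at \<omega> k) - real_of_int k / p\<bar> =
        \<bar>- real_of_int (ray \<omega> (-1) (nat (- k))) - 1 / p * real (nat (- k))\<bar>"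
      by (subst abs_minus_cancel[symmetric]) (simp add: point_at_def)
    also have "\<dots> \<le> \<epsilon> * \<bar>real_of_int k\<bar> + D"
      using D[of "nat (- k)"] False by simp
    finally show ?thesis by simp
  qed
  then show ?thesis by (intro exI[of _ "max 0 (max C D)"]) auto
qed

section \<open>The mean gap under the Palm measure\<close>

context stationary_ergodic_env
begin

lemma measurable_next_dist [measurable]: "next_dist e \<in> measurable Q (count_space UNIV)"
  unfolding next_dist_def by measurable

text \<open>
  Kac's argument: up to a null set the event \<open>0 \<in> points \<omega>, t < next_dist 1 \<omega>\<close> says that
  \<open>{1..t}\<close> is empty but \<open>{0..t}\<close> is not, so by stationarity the tail probabilities telescope.
\<close>

lemma nn_integral_next_dist:
  "(\<integral>\<^sup>+\<omega>. of_nat (next_dist 1 \<omega>) * indicator Omega0 \<omega> \<partial>Q) = 1"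
proof -
  define empty :: "nat \<Rightarrow> env \<Rightarrow> bool" where "empty t \<omega> \<longleftrightarrow> (\<forall>j<t. \<not> \<omega> (int (Suc j)))" for t \<omega>
  have empty_meas [measurable]: "Measurable.pred env_space (empty t)" for t
    unfolding empty_def by measurable
  have empty_sets [measurable]: "{\<omega>. empty t \<omega>} \<in> events" for t
  proof -
    have "{\<omega> \<in> space Q. empty t \<omega>} \<in> events" by measurable
    then show ?thesis by simp
  qed
  \<comment> \<open>Extending the gap by 0 off \<open>Omega0\<close> puts the condition that the
    origin is a point into the event \<open>t < h \<omega>\<close>.\<close>
  define h where "h \<omega> = (if \<omega> \<in> Omega0 then next_dist 1 \<omega> else 0)" for \<omega>
  have h_meas [measurable]: "h \<in> measurable Q (count_space UNIV)"
    unfolding h_def by measurable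
  have tail: "emeasure Q {\<omega> \<in> space Q. t < h \<omega>} = ennreal (prob {\<omega>. empty t \<omega>} - prob {\<omega>. empty (Suc t) \<omega>})" for t
  proof -
    have ev: "AE \<omega> in Q. t < h \<omega> \<longleftrightarrow> \<omega> \<in> {\<omega>. empty t \<omega>} - {\<omega>. empty t \<omega> \<and> \<not> \<omega> 0}"
      using AE_has_density
    proof eventually_elim
      case (elim \<omega>)
      have ts: "two_sided \<omega>" using has_density_two_sided[OF elim intensity_pos] .
      have "\<omega> (int (next_dist 1 \<omega>))" "0 < next_dist 1 \<omega>"
        using next_dist_props[OF ts, of 1 0] by (simp_all add: step_def)
      then obtain d where d: "next_dist 1 \<omega> = Suc d" "\<omega> (int (Suc d))"
        by (metis not0_implies_Suc not_gr_zero)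
      have "t < next_dist 1 \<omega> \<longleftrightarrow> empty t \<omega>"
      proof
        assume "t < next_dist 1 \<omega>"
        then have "\<not> (0 < Suc j \<and> \<omega> (int (Suc j) * 1))" if "j < t" for j
          using that unfolding next_dist_def by (intro not_less_Least) simp
        then show "empty t \<omega>" by (simp add: empty_def)
      next
        assume "empty t \<omega>"
        then have "\<not> d < t" using d(2) by (auto simp: empty_def)
        then show "t < next_dist 1 \<omega>" by (simp add: d(1))
      qed
      then show ?case by (auto simp: h_def Omega0_def)
    qed
    have sub_sets [measurable]: "{\<omega>. empty t \<omega> \<and> \<not> \<omega> 0} \<in> events"
    proof -
      have "{\<omega> \<in> space Q. empty t \<omega> \<and> \<not> \<omega> 0} \<in> events" by measurable
      then show ?thesis by simp
    qed
    have "{\<omega> \<in> space Q. t < h \<omega>} \<in> events" by measurable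
    then have "prob {\<omega> \<in> space Q. t < h \<omega>} = prob ({\<omega>. empty t \<omega>} - {\<omega>. empty t \<omega> \<and> \<not> \<omega> 0})"
      using ev by (intro finite_measure_eq_AE) auto
    also have "\<dots> = prob {\<omega>. empty t \<omega>} - prob {\<omega>. empty t \<omega> \<and> \<not> \<omega> 0}"
      by (intro finite_measure_Diff) auto
    \<comment> \<open>Translation by one site turns the vacancy of \<open>{0..t}\<close> into that
      of \<open>{1..t+1}\<close>, which is \<open>empty (Suc t)\<close>.\<close>
    also have "prob {\<omega>. empty t \<omega> \<and> \<not> \<omega> 0} = prob {\<omega>. empty t (shift 1 \<omega>) \<and> \<not> shift 1 \<omega> 0}"
      by (rule prob_shift[symmetric]) auto
    also have "(\<lambda>\<omega>. empty t (shift 1 \<omega>) \<and> \<not> shift 1 \<omega> 0) = empty (Suc t)"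
      by (auto simp: fun_eq_iff empty_def shift_def All_less_Suc2)
    finally show ?thesis by (simp add: emeasure_eq_measure)
  qed
  \<comment> \<open>These events decrease to the absence of any point to the right of the origin, a
    null event by the positive density.\<close>
  have lim: "(\<lambda>t. prob {\<omega>. empty t \<omega>}) \<longlonglongrightarrow> 0"
  proof -
    have "(\<lambda>t. prob {\<omega>. empty t \<omega>}) \<longlonglongrightarrow> prob (\<Inter>t. {\<omega>. empty t \<omega>})"
    proof (rule finite_Lim_measure_decseq)
      show "decseq (\<lambda>t. {\<omega>. empty t \<omega>})" by (auto simp: decseq_def empty_def)
    qed auto
    moreover have "AE \<omega> in Q. \<omega> \<notin> (\<Inter>t. {\<omega>. empty t \<omega>})"
      using AE_has_density
    proof eventually_elim
      case (elim \<omega>)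
      obtain j where "1 \<le> j" "\<omega> (int j * 1)"
        using has_density_unbounded[OF elim intensity_pos, of 1 1] by auto
      then obtain i where "\<omega> (int (Suc i))" by (cases j) auto
      then have "\<not> empty (Suc i) \<omega>" unfolding empty_def by blast
      then show ?case by blast
    qed
    then have "prob (\<Inter>t. {\<omega>. empty t \<omega>}) = 0"
      by (subst prob_eq_0) auto
    ultimately show ?thesis by simp
  qed
  have "prob {\<omega>. empty 0 \<omega>} = 1"
    using prob_space by (simp add: empty_def)
  with telescope_sums'[OF lim]
  have sums: "(\<lambda>t. prob {\<omega>. empty t \<omega>} - prob {\<omega>. empty (Suc t) \<omega>}) sums 1" by simp
  have "(\<integral>\<^sup>+\<omega>. of_nat (next_dist 1 \<omega>) * indicator Omega0 \<omega> \<partial>Q) = (\<integral>\<^sup>+\<omega>. of_nat (h \<omega>) \<partial>Q)"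
    by (intro nn_integral_cong) (auto simp: h_def)
  \<comment> \<open>The expectation of a natural-valued variable is the sum of its tail
    probabilities.\<close>
  also have "\<dots> = (\<Sum>t. ennreal (prob {\<omega>. empty t \<omega>} - prob {\<omega>. empty (Suc t) \<omega>}))"
    unfolding nn_integral_nat_function[OF h_meas] tail ..
  also have "\<dots> = ennreal 1"
  proof (rule suminf_ennreal_eq[OF _ sums])
    have "{\<omega>. empty (Suc t) \<omega>} \<subseteq> {\<omega>. empty t \<omega>}" for t by (auto simp: empty_def)
    then show "0 \<le> prob {\<omega>. empty t \<omega>} - prob {\<omega>. empty (Suc t) \<omega>}" for t
      by (simp add: finite_measure_mono)
  qed
  finally show ?thesis by simp
qed

text \<open>Kac's formula: conditioning on \<open>Omega0\<close> divides the integral just computed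
  by \<open>intensity\<close>. For the nonnegative gap the Lebesgue integral is the real value of
  this finite extended integral.\<close>

theorem integral_next_dist: "(\<integral>\<omega>. real (next_dist 1 \<omega>) \<partial>palm Q) = 1 / intensity"
proof -
  have palm_meas: "next_dist 1 \<in> measurable (palm Q) (count_space UNIV)"
    using measurable_next_dist measurable_cong_sets[of "palm Q" Q] by (auto simp: palm_def)
  have "(\<integral>\<^sup>+\<omega>. ennreal (real (next_dist 1 \<omega>)) \<partial>palm Q)
      = (\<integral>\<^sup>+\<omega>. of_nat (next_dist 1 \<omega>) * indicator Omega0 \<omega> \<partial>Q) / emeasure Q Omega0"
    unfolding palm_def by (subst nn_integral_uniform_measure) (auto simp: ennreal_of_nat_eq_real_of_nat)
  also have "\<dots> = ennreal (1 / intensity)"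
    unfolding nn_integral_next_dist emeasure_eq_measure intensity_def[symmetric]
    using divide_ennreal[of 1 intensity] intensity_pos by simp
  finally show ?thesis
    using palm_meas intensity_pos
    by (subst integral_eq_nn_integral) (auto intro: measurable_compose)
qed

end

section \<open>The central limit theorem for the walk\<close>

lemma normal_density_std_scale:
  assumes "0 < m"
  shows "density lborel (normal_density 0 m) = distr std_normal_distribution borel (\<lambda>x. m * x)"
proof -
  interpret N: prob_space std_normal_distribution by (rule prob_space_normal_density) simp
  have "distributed std_normal_distribution lborel (\<lambda>x. x) std_normal_density"
    unfolding distributed_def by (simp add: distr_id2)
  from N.normal_density_affine[OF this, of m 0] assms
  have "distributed std_normal_distribution lborel (\<lambda>x. m * x) (normal_density 0 m)" by simp
  then have "distr std_normal_distribution lborel (\<lambda>x. m * x) = density lborel (normal_density 0 m)"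
    by (simp add: distributed_def)
  moreover have "distr std_normal_distribution lborel (\<lambda>x. m * x) = distr std_normal_distribution borel (\<lambda>x. m * x)"
    by (rule distr_cong) auto
  ultimately show ?thesis by simp
qed

lemma char_scale:
  assumes [measurable]: "X \<in> borel_measurable M"
  shows "char (distr M borel (\<lambda>x. m * X x)) t = char (distr M borel X) (t * m)"
  unfolding char_def by (subst (1 2) integral_distr) (auto simp: algebra_simps)

text \<open>Factoring out \<open>iexp y\<close>, which has modulus 1, reduces this to the
  zeroth-order Taylor bound at \<open>x - y\<close>.\<close>

lemma norm_iexp_diff_le: "cmod (iexp x - iexp y) \<le> \<bar>x - y\<bar>"
proof -
  have "iexp x - iexp y = iexp y * (iexp (x - y) - 1)"
    by (simp add: algebra_simps exp_diff)
  then have "cmod (iexp x - iexp y) = cmod (iexp (x - y) - 1)"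
    by (simp add: norm_mult)
  also have "\<dots> \<le> \<bar>x - y\<bar>" using iexp_approx1[of "x - y" 0] by simp
  finally show ?thesis .
qed

text \<open>A Slutsky-type argument: at \<open>t\<close> the two characteristic functions differ by
  at most \<bar>t\<bar> times the mean distance of \<open>X n\<close> and \<open>Y n\<close>. This
  tends to 0, and Levy's continuity theorem turns convergence of characteristic functions into weak
  convergence.\<close>

lemma (in prob_space) weak_conv_add_L1:
  fixes X Y :: "nat \<Rightarrow> 'a \<Rightarrow> real"
  assumes X [measurable]: "\<And>n. X n \<in> borel_measurable M"
    and Y [measurable]: "\<And>n. Y n \<in> borel_measurable M"
    and N: "real_distribution N"
    and conv: "\<And>t. (\<lambda>n. char (distr M borel (X n)) t) \<longlonglongrightarrow> char N t"
    and int: "\<And>n. integrable M (\<lambda>x. \<bar>Y n x - X n x\<bar>)"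
    and lim: "(\<lambda>n. \<integral>x. \<bar>Y n x - X n x\<bar> \<partial>M) \<longlonglongrightarrow> 0"
  shows "weak_conv_m (\<lambda>n. distr M borel (Y n)) N"
proof (rule levy_continuity[OF _ N])
  show "real_distribution (distr M borel (Y n))" for n by simp
  fix t
  have int_iexp: "integrable M (\<lambda>x. iexp (t * Z x))" if [measurable]: "Z \<in> borel_measurable M" for Z :: "'a \<Rightarrow> real"
    by (intro integrable_iexp) auto
  have char: "char (distr M borel Z) t = (\<integral>x. iexp (t * Z x) \<partial>M)"
    if [measurable]: "Z \<in> borel_measurable M" for Z :: "'a \<Rightarrow> real"
    unfolding char_def by (subst integral_distr) auto
  have "cmod (char (distr M borel (Y n)) t - char (distr M borel (X n)) t) \<le> \<bar>t\<bar> * (\<integral>x. \<bar>Y n x - X n x\<bar> \<partial>M)" for n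
  proof -
    have "char (distr M borel (Y n)) t - char (distr M borel (X n)) t =
        (\<integral>x. iexp (t * Y n x) - iexp (t * X n x) \<partial>M)"
      unfolding char[OF X] char[OF Y] by (intro Bochner_Integration.integral_diff[symmetric] int_iexp X Y)
    also have "cmod \<dots> \<le> (\<integral>x. cmod (iexp (t * Y n x) - iexp (t * X n x)) \<partial>M)"
      by (rule integral_norm_bound)
    also have "\<dots> \<le> (\<integral>x. \<bar>t\<bar> * \<bar>Y n x - X n x\<bar> \<partial>M)"
    proof (rule integral_mono)
      show "cmod (iexp (t * Y n x) - iexp (t * X n x)) \<le> \<bar>t\<bar> * \<bar>Y n x - X n x\<bar>" for x
        using norm_iexp_diff_le[of "t * Y n x" "t * X n x"]
        by (simp add: abs_mult flip: right_diff_distrib)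
      show "integrable M (\<lambda>x. cmod (iexp (t * Y n x) - iexp (t * X n x)))"
        by (intro integrable_norm Bochner_Integration.integrable_diff int_iexp X Y)
      show "integrable M (\<lambda>x. \<bar>t\<bar> * \<bar>Y n x - X n x\<bar>)"
        using int by simp
    qed
    finally show ?thesis using int by simp
  qed
  then have "(\<lambda>n. char (distr M borel (Y n)) t - char (distr M borel (X n)) t) \<longlonglongrightarrow> 0"
    by (intro Lim_null_comparison[OF always_eventually tendsto_mult_right_zero[OF lim]]) auto
  from tendsto_add[OF this conv[of t]]
  show "(\<lambda>n. char (distr M borel (Y n)) t) \<longlonglongrightarrow> char N t" by simp
qed

section \<open>Simple random walk: independence, central limit theorem, second moment\<close>

interpretation coins: prob_space coins
  by (intro prob_space_PiM prob_space_measure_pmf)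

text \<open>The space of \<open>coins\<close> is the set of all integer sequences, so the
  restriction to signs holds only almost everywhere.\<close>

lemma AE_coins: "AE c in coins. \<forall>i. c i \<in> {1, -1}"
  unfolding AE_all_countable
proof
  fix i :: nat
  have "AE s in coin. s \<in> {1, -1}" by (simp add: AE_measure_pmf_iff)
  then show "AE c in coins. c i \<in> {1, -1}"
    by (intro AE_PiM_component[where P = "\<lambda>s. s \<in> {1, -1}"] prob_space_measure_pmf) auto
qed

lemma measurable_coin_coord [measurable]: "(\<lambda>c. c i) \<in> measurable coins (count_space UNIV)"
  using measurable_coord measurable_cong_sets[OF sets_coins refl] by blast

lemma integral_coins_coord: "(\<integral>c. f (c i) \<partial>coins) = (f 1 + f (-1)) / (2::real)"
proof -
  have "(\<integral>c. f (c i) \<partial>coins) = (\<integral>s. f s \<partial>distr coins coin (\<lambda>c. c i))"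
    by (subst integral_distr) auto
  also have "distr coins coin (\<lambda>c. c i) = coin"
    by (rule distr_PiM_component) (auto intro: prob_space_measure_pmf)
  also have "(\<integral>s. f s \<partial>coin) = (f 1 + f (-1)) / 2"
    by (subst integral_pmf_of_set) (auto simp: add.commute)
  finally show ?thesis .
qed

lemma indep_coins: "coins.indep_vars (\<lambda>_. borel) (\<lambda>i c. real_of_int (c i)) UNIV"
proof -
  have "coins.indep_vars (\<lambda>_. coin) (\<lambda>i c. c i) UNIV"
  proof (subst coins.indep_vars_iff_distr_eq_PiM)
    have "distr coins coin (\<lambda>c. c i) = coin" for i
      by (rule distr_PiM_component) (auto intro: prob_space_measure_pmf)
    then show "distr coins coins (\<lambda>x. \<lambda>i\<in>UNIV. x i) = Pi\<^sub>M UNIV (\<lambda>i. distr coins coin (\<lambda>c. c i))"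
      by (simp add: distr_id2 restrict_UNIV)
  qed auto
  then show ?thesis by (rule coins.indep_vars_compose2) auto
qed

definition coin_sum :: "nat \<Rightarrow> (nat \<Rightarrow> int) \<Rightarrow> int" where
  "coin_sum n c = (\<Sum>i<n. c i)"

lemma measurable_coin_sum [measurable]: "coin_sum n \<in> measurable coins (count_space UNIV)"
  unfolding coin_sum_def[abs_def]
proof (induction n)
  case (Suc n)
  have "(\<lambda>c. x + c n) \<in> measurable coins (count_space UNIV)" for x
    by (rule measurable_compose[OF measurable_coin_coord]) simp
  from measurable_compose_countable[OF this Suc] show ?case by simp
qed simp

lemma coin_sum_CLT:
  "weak_conv_m (\<lambda>n. distr coins borel (\<lambda>c. real_of_int (coin_sum n c) / sqrt (real n)))
     std_normal_distribution"
proof -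
  have "distr coins borel (\<lambda>c. real_of_int (c i)) = distr coin borel real_of_int" for i
  proof -
    have "distr coin borel real_of_int = distr (distr coins coin (\<lambda>c. c i)) borel real_of_int"
      by (subst distr_PiM_component) (auto intro: prob_space_measure_pmf)
    also have "\<dots> = distr coins borel (\<lambda>c. real_of_int (c i))"
      by (subst distr_distr) (auto simp: comp_def)
    finally show ?thesis ..
  qed
  moreover have "integrable coins (\<lambda>c. (real_of_int (c i))\<^sup>2)" for i
  proof (rule coins.integrable_const_bound[where B = 1])
    show "AE c in coins. norm ((real_of_int (c i))\<^sup>2) \<le> 1"
      using AE_coins by eventually_elim (auto dest!: spec[of _ i])
  qed measurable
  moreover have mean: "coins.expectation (\<lambda>c. real_of_int (c i)) = 0" for i
    by (simp add: integral_coins_coord[where f = real_of_int])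
  moreover have "coins.variance (\<lambda>c. real_of_int (c i)) = 1\<^sup>2" for i
    unfolding mean by (simp add: integral_coins_coord[where f = "\<lambda>s. (real_of_int s)\<^sup>2"])
  ultimately have "weak_conv_m (\<lambda>n. distr coins borel (\<lambda>c. (\<Sum>i<n. real_of_int (c i)) / sqrt (real n * 1\<^sup>2)))
      std_normal_distribution"
    by (intro coins.central_limit_theorem_zero_mean indep_coins) auto
  then show ?thesis by (simp add: coin_sum_def)
qed

text \<open>The square grows by \<open>2 * c n * coin_sum n c + 1\<close> at each step, almost
  surely; the cross term has mean 0 because the new coin is centred and independent of the past.
  Integrability comes from the bound \<open>n\<close> on the sum.\<close>

lemma coin_sum_second_moment:
  "integrable coins (\<lambda>c. (real_of_int (coin_sum n c))\<^sup>2)"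
  "(\<integral>c. (real_of_int (coin_sum n c))\<^sup>2 \<partial>coins) = real n"
proof -
  have bound: "AE c in coins. \<bar>real_of_int (coin_sum n c)\<bar> \<le> real n" for n
    using AE_coins
  proof eventually_elim
    case (elim c)
    have "\<bar>real_of_int (coin_sum n c)\<bar> \<le> (\<Sum>i<n. \<bar>real_of_int (c i)\<bar>)"
      by (simp add: coin_sum_def)
    also have "\<dots> = (\<Sum>i<n. 1)"
    proof (intro sum.cong refl)
      show "\<bar>real_of_int (c i)\<bar> = 1" for i using elim[rule_format, of i] by auto
    qed
    finally show ?case by simp
  qed
  have int1: "integrable coins (\<lambda>c. real_of_int (coin_sum n c))" for n
    using bound[of n] by (intro coins.integrable_const_bound[where B = "real n"]) auto
  have int2: "integrable coins (\<lambda>c. (real_of_int (coin_sum n c))\<^sup>2)" for n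
  proof (rule coins.integrable_const_bound[where B = "(real n)\<^sup>2"])
    show "AE c in coins. norm ((real_of_int (coin_sum n c))\<^sup>2) \<le> (real n)\<^sup>2"
      using bound[of n] by eventually_elim (simp add: abs_le_square_iff[symmetric])
  qed measurable
  show "integrable coins (\<lambda>c. (real_of_int (coin_sum n c))\<^sup>2)" by (rule int2)
  have intc: "integrable coins (\<lambda>c. real_of_int (c n))" for n
  proof (rule coins.integrable_const_bound[where B = 1])
    show "AE c in coins. norm (real_of_int (c n)) \<le> 1"
      using AE_coins
    proof eventually_elim
      case (elim c)
      then show ?case by (auto dest!: spec[of _ n])
    qed
  qed measurable
  show "(\<integral>c. (real_of_int (coin_sum n c))\<^sup>2 \<partial>coins) = real n"
  proof (induction n)
    case 0
    show ?case by (simp add: coin_sum_def)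
  next
    case (Suc n)
    \<comment> \<open>Writing the indices as \<open>insert n {..<n}\<close> separates the new coin
      from the sum of the earlier ones.\<close>
    have "coins.indep_vars (\<lambda>_. borel) (\<lambda>i c. real_of_int (c i)) (insert n {..<n})"
      by (rule coins.indep_vars_subset[OF indep_coins]) simp
    from coins.indep_vars_sum[OF _ _ this]
    have ind: "coins.indep_var borel (\<lambda>c. real_of_int (c n)) borel (\<lambda>c. real_of_int (coin_sum n c))"
      by (simp add: coin_sum_def)
    have cross_int: "integrable coins (\<lambda>c. real_of_int (c n) * real_of_int (coin_sum n c))"
      by (rule coins.indep_var_integrable[OF ind intc int1])
    have cross: "(\<integral>c. real_of_int (c n) * real_of_int (coin_sum n c) \<partial>coins) = 0"
      by (subst coins.indep_var_lebesgue_integral[OF ind intc int1])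
        (simp add: integral_coins_coord[where f = real_of_int])
    have "(\<integral>c. (real_of_int (coin_sum (Suc n) c))\<^sup>2 \<partial>coins) =
        (\<integral>c. (real_of_int (coin_sum n c))\<^sup>2 + 2 * (real_of_int (c n) * real_of_int (coin_sum n c)) + 1 \<partial>coins)"
    proof (rule integral_cong_AE)
      show "AE c in coins. (real_of_int (coin_sum (Suc n) c))\<^sup>2 =
          (real_of_int (coin_sum n c))\<^sup>2 + 2 * (real_of_int (c n) * real_of_int (coin_sum n c)) + 1"
        using AE_coins
      proof eventually_elim
        case (elim c)
        then have "(real_of_int (c n))\<^sup>2 = 1" by (auto dest!: spec[of _ n])
        then show ?case by (simp add: coin_sum_def power2_sum)
      qed
    qed measurable
    also have "\<dots> = real n + 1"
      using int2[of n] cross_int Suc cross coins.prob_space by simp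
    finally show ?case by simp
  qed
qed

text \<open>\<open>G (coin_sum n c)\<close> is compared with \<open>m * coin_sum n c\<close>: after
  division by \<open>sqrt n\<close> they are close in mean, since the second moment of the coin sum
  is \<open>n\<close>, and the scaled coin sum has the normal limit.\<close>

lemma weak_conv_linear_coin_sum:
  fixes G :: "int \<Rightarrow> real"
  assumes "0 < m"
    and G: "\<And>\<epsilon>. 0 < \<epsilon> \<Longrightarrow> \<exists>C\<ge>0. \<forall>k. \<bar>G k - m * real_of_int k\<bar> \<le> \<epsilon> * \<bar>real_of_int k\<bar> + C"
  shows "weak_conv_m (\<lambda>n. distr coins borel (\<lambda>c. G (coin_sum n c) / sqrt (real n)))
     (density lborel (normal_density 0 m))"
proof -
  let ?S = "\<lambda>n c. real_of_int (coin_sum n c) / sqrt (real n)"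
  let ?X = "\<lambda>n c. m * ?S n c" and ?Y = "\<lambda>n c. G (coin_sum n c) / sqrt (real n)"
  have G_meas [measurable]: "(\<lambda>c. G (coin_sum n c)) \<in> borel_measurable coins" for n
    by (rule measurable_compose[OF measurable_coin_sum]) simp
  have dominated: "\<exists>C\<ge>0. \<forall>n c. \<bar>?Y n c - ?X n c\<bar> \<le>
      \<epsilon> * ((1 + (real_of_int (coin_sum n c))\<^sup>2 / real n) / 2) + C / sqrt (real n)" if eps: "0 < \<epsilon>" for \<epsilon>
  proof -
    obtain C where C: "0 \<le> C" "\<And>k. \<bar>G k - m * real_of_int k\<bar> \<le> \<epsilon> * \<bar>real_of_int k\<bar> + C"
      using G[OF eps] by blast
    have "\<bar>?Y n c - ?X n c\<bar> \<le> \<epsilon> * ((1 + (real_of_int (coin_sum n c))\<^sup>2 / real n) / 2) + C / sqrt (real n)" for n c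
    proof -
      have "\<bar>?Y n c - ?X n c\<bar> = \<bar>G (coin_sum n c) - m * real_of_int (coin_sum n c)\<bar> / sqrt (real n)"
        by (simp flip: diff_divide_distrib)
      also have "\<dots> \<le> (\<epsilon> * \<bar>real_of_int (coin_sum n c)\<bar> + C) / sqrt (real n)"
        using C(2) by (intro divide_right_mono) auto
      also have "\<dots> = \<epsilon> * \<bar>?S n c\<bar> + C / sqrt (real n)" by (simp add: add_divide_distrib)
      also have "\<dots> \<le> \<epsilon> * ((1 + (real_of_int (coin_sum n c))\<^sup>2 / real n) / 2) + C / sqrt (real n)"
      proof -
        \<comment> \<open>This trades the absolute value of the scaled sum for its square, whose
          mean is known exactly.\<close>
        have "x \<le> (1 + x\<^sup>2) / 2" for x :: real
          using sum_squares_bound[of 1 x] by simp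
        moreover have "\<bar>?S n c\<bar>\<^sup>2 = (real_of_int (coin_sum n c))\<^sup>2 / real n"
          by (simp add: power_divide)
        ultimately have "\<bar>?S n c\<bar> \<le> (1 + (real_of_int (coin_sum n c))\<^sup>2 / real n) / 2"
          by metis
        then show ?thesis using eps by (intro add_right_mono mult_left_mono) auto
      qed
      finally show ?thesis .
    qed
    with C(1) show ?thesis by blast
  qed
  have int_bound: "integrable coins (\<lambda>c. \<epsilon> * ((1 + (real_of_int (coin_sum n c))\<^sup>2 / real n) / 2) + C / sqrt (real n))" for \<epsilon> C n
    using coin_sum_second_moment(1)[of n] by simp
  have int: "integrable coins (\<lambda>c. \<bar>?Y n c - ?X n c\<bar>)" for n
  proof -
    obtain C where "\<And>n c. \<bar>?Y n c - ?X n c\<bar> \<le>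
      1 * ((1 + (real_of_int (coin_sum n c))\<^sup>2 / real n) / 2) + C / sqrt (real n)"
      using dominated[of 1] by auto
    then show ?thesis
      by (intro Bochner_Integration.integrable_bound[OF int_bound[of 1 n C]]) (auto intro: order_trans[OF _ abs_ge_self])
  qed
  have lim: "(\<lambda>n. \<integral>c. \<bar>?Y n c - ?X n c\<bar> \<partial>coins) \<longlonglongrightarrow> 0"
  proof (rule tendstoI)
    fix e :: real assume "0 < e"
    \<comment> \<open>With \<epsilon> equal to \<open>e / 2\<close> the quadratic part integrates to
      exactly \<open>e / 2\<close> for \<open>n > 0\<close>, where \<open>real n / real n\<close> is
      1; the constant part falls below \<open>e / 2\<close> for large \<open>n\<close>.\<close>
    obtain C where C: "0 \<le> C" "\<And>n c. \<bar>?Y n c - ?X n c\<bar> \<le>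
      e / 2 * ((1 + (real_of_int (coin_sum n c))\<^sup>2 / real n) / 2) + C / sqrt (real n)"
      using dominated[of "e / 2"] \<open>0 < e\<close> by auto
    have "(\<lambda>n. C / sqrt (real n)) \<longlonglongrightarrow> 0"
      by (intro tendsto_divide_0[OF tendsto_const] filterlim_at_top_imp_at_infinity
          filterlim_compose[OF sqrt_at_top] filterlim_real_sequentially)
    then have "\<forall>\<^sub>F n in sequentially. C / sqrt (real n) < e / 2"
      using \<open>0 < e\<close> by (intro order_tendstoD) auto
    then show "\<forall>\<^sub>F n in sequentially. dist (\<integral>c. \<bar>?Y n c - ?X n c\<bar> \<partial>coins) 0 < e"
      using eventually_gt_at_top[of 0]
    proof eventually_elim
      case (elim n)
      have "(\<integral>c. \<bar>?Y n c - ?X n c\<bar> \<partial>coins) \<le>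
          (\<integral>c. e / 2 * ((1 + (real_of_int (coin_sum n c))\<^sup>2 / real n) / 2) + C / sqrt (real n) \<partial>coins)"
        by (intro integral_mono int int_bound C)
      also have "\<dots> = e / 2 * ((1 + real n / real n) / 2) + C / sqrt (real n)"
        using coin_sum_second_moment[of n] coins.prob_space by simp
      also have "\<dots> = e / 2 + C / sqrt (real n)" using elim(2) by simp
      also have "\<dots> < e / 2 + e / 2" using elim(1) by (rule add_strict_left_mono)
      also have "\<dots> = e" by simp
      finally show ?case by (simp add: integral_nonneg_AE)
    qed
  qed
  have std: "real_distribution std_normal_distribution" by (rule real_dist_normal_dist)
  interpret std: real_distribution std_normal_distribution by (rule std)
  \<comment> \<open>The factor \<open>m\<close> moves into the argument of the characteristic
    function on both sides, which leaves the standard limit theorem at \<open>t * m\<close>.\<close>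
  have "(\<lambda>n. char (distr coins borel (?X n)) t) \<longlonglongrightarrow> char (density lborel (normal_density 0 m)) t" for t
  proof -
    have "(\<lambda>n. char (distr coins borel (?S n)) (t * m)) \<longlonglongrightarrow> char std_normal_distribution (t * m)"
      by (rule levy_continuity1[OF _ std coin_sum_CLT]) (rule coins.real_distribution_distr, measurable)
    moreover have "char (density lborel (normal_density 0 m)) t = char std_normal_distribution (t * m)"
      unfolding normal_density_std_scale[OF \<open>0 < m\<close>]
      using char_scale[of "\<lambda>x. x" std_normal_distribution m t] by (simp add: distr_id2)
    ultimately show ?thesis by (subst char_scale) (auto simp: mult.commute)
  qed
  moreover have "real_distribution (density lborel (normal_density 0 m))"
    unfolding normal_density_std_scale[OF \<open>0 < m\<close>] by (rule std.real_distribution_distr) simp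
  ultimately show ?thesis
    by (intro coins.weak_conv_add_L1[where X = ?X] int lim) auto
qed

section \<open>Transfer to the quenched law\<close>

lemma quenched_law_eq: "two_sided \<omega> \<Longrightarrow> quenched_law \<omega> = distr coins path_space (walk \<omega> 0)"
  unfolding quenched_law_def using ex1_walk_law walk_law_exists by (intro the1_equality)

text \<open>For a fixed environment the comparison lemma applies with \<open>G\<close> the
  enumeration of the points and \<open>m = 1 / p\<close>.\<close>

lemma quenched_CLT:
  assumes "has_density \<omega> p" "0 < p" "\<omega> 0"
  shows "weak_conv_m
    (\<lambda>n. distr (quenched_law \<omega>) borel (\<lambda>X. real_of_int (X n) / sqrt (real n)))
    (density lborel (normal_density 0 (1 / p)))"
proof -
  have ts: "two_sided \<omega>" using has_density_two_sided[OF assms(1,2)] .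
  have "distr (quenched_law \<omega>) borel (\<lambda>X. real_of_int (X n) / sqrt (real n)) =
      distr coins borel (\<lambda>c. real_of_int (point_at \<omega> (coin_sum n c)) / sqrt (real n))" for n
  proof -
    have "distr (quenched_law \<omega>) borel (\<lambda>X. real_of_int (X n) / sqrt (real n)) =
        distr coins borel (\<lambda>c. real_of_int (walk \<omega> 0 c n) / sqrt (real n))"
      unfolding quenched_law_eq[OF ts] by (subst distr_distr) (auto simp: comp_def)
    \<comment> \<open>The walk follows \<open>point_at\<close> only along sequences of signs; these
      have full measure, so the laws agree.\<close>
    also have "\<dots> = distr coins borel (\<lambda>c. real_of_int (point_at \<omega> (coin_sum n c)) / sqrt (real n))"
    proof (rule distr_cong_AE)
      show "AE c in coins. real_of_int (walk \<omega> 0 c n) / sqrt (real n) =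
          real_of_int (point_at \<omega> (coin_sum n c)) / sqrt (real n)"
        using AE_coins by eventually_elim (simp only: walk_eq_point_at[OF ts assms(3)] coin_sum_def)
    qed auto
    finally show ?thesis .
  qed
  moreover have "weak_conv_m
      (\<lambda>n. distr coins borel (\<lambda>c. real_of_int (point_at \<omega> (coin_sum n c)) / sqrt (real n)))
      (density lborel (normal_density 0 (1 / p)))"
    using assms point_at_linear[OF assms]
    by (intro weak_conv_linear_coin_sum[where G = "\<lambda>k. real_of_int (point_at \<omega> k)"]) auto
  ultimately show ?thesis by simp
qed

theorem theorem1p9:
  fixes Q :: "env measure"
  assumes "env_law Q"
  shows "AE \<omega> in palm Q.
    weak_conv_m
      (\<lambda>n. distr (quenched_law \<omega>) borel (\<lambda>X. real_of_int (X n) / sqrt (real n)))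
      (density lborel (normal_density 0 (\<integral>\<eta>. real (next_dist 1 \<eta>) \<partial>palm Q)))"
proof -
  interpret stationary_ergodic_env Q using assms by unfold_locales
  \<comment> \<open>As \<open>Omega0\<close> has positive finite mass, almost surely under
    \<open>palm Q\<close> means almost surely under \<open>Q\<close> on
    \<open>Omega0\<close>.\<close>
  have "emeasure Q Omega0 \<noteq> 0" "emeasure Q Omega0 < \<infinity>"
    using intensity_pos by (auto simp: emeasure_eq_measure intensity_def)
  moreover have "AE \<omega> in Q. \<omega> \<in> Omega0 \<longrightarrow> weak_conv_m
      (\<lambda>n. distr (quenched_law \<omega>) borel (\<lambda>X. real_of_int (X n) / sqrt (real n)))
      (density lborel (normal_density 0 (1 / intensity)))"
    using AE_has_density
    by eventually_elim (auto simp: Omega0_def intro: quenched_CLT intensity_pos)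
  ultimately show ?thesis
    unfolding integral_next_dist by (subst palm_def) (simp add: AE_uniform_measure)
qed

end
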